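(* (Parabolic Hopf Lemma) Let $\Omega\subset\mathbb{R}^{n+1}$ (points $(x,t)$, $x=(x_1,\dots,x_n)\in\mathbb{R}^n$, $t\in\mathbb{R}$) be a bounded connected open set lying in $\{t<0\}$, and suppose that $\partial\Omega$ includes a relatively open subset $\Sigma$ of the hypersurface $\{t=0\}$. Let $F(x,t,s,p,M)$, defined for $(x,t)\in\overline\Omega$, $s\in\mathbb{R}$, $p\in\mathbb{R}^n$, $M\in\mathcal{S}^{n\times n}$, be continuous and of class $C^1$ in $(s,p,M)$, with $\big(\frac{\partial F}{\partial M_{ij}}\big)$ positive definite for all values of the arguments. Suppose that the origin $0$ lies on $\partial\Sigma$ (the boundary of $\Sigma$ relative to $\{t=0\}$), that the parabolic boundary $P\partial\Omega:=\partial\Omega\setminus\Sigma$ is of class $C^2$ near $0$, that $\partial\Sigma$ is of class $C^2$ near $0$ with inner normal $\nu=(0,\dots,0,1,0)$ at $0$ (the unit vector in the $x_n$-direction), and that the interior normal to $P\partial\Omega$ at $0$ is not $(0,\dots,0,1)$. Let $u,v$ be functions on $\overline\Omega$, with $u$ lower semicontinuous and $v\in C^2$, such that $$F(x,t,u,\nabla u,\nabla^2u)-u_t\le F(x,t,v,\nabla v,\nabla^2v)-v_t\quad\text{in }\Omega\cup\Sigma\text{ in the viscosity sense},$$ $$u\ge v\ \text{ in }\overline\Omega,\qquad u>v\ \text{ in }\Omega\cup\Sigma,\qquad u(0)=v(0).$$ Then $$\liminf_{s\to0^+}\frac{(u-v)(s\nu)}{s}>0.$$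
   Context: $\nabla,\nabla^2$ denote first and second derivatives in the $x$-variables; $\mathcal{S}^{n\times n}$ is the set of real symmetric $n\times n$ matrices. "Of class $C^1$ in $(s,p,M)$" means the partial derivatives in $(s,p,M)$ exist and are continuous in all arguments. No uniform ellipticity and no uniform bounds on $|F_s|,|F_{p_i}|$ are assumed. Near $0$, $P\partial\Omega$ is a $C^2$ hypersurface with boundary $\partial\Sigma$, and $\Omega$ lies on one side of it (within $\{t<0\}$). Viscosity sense on $\Omega\cup\Sigma$: whenever $(x_0,t_0)\in\Omega\cup\Sigma$ and $\varphi$ is a $C^2$ function near $(x_0,t_0)$ with $\varphi\le u$ at the points of $\Omega\cup\Sigma$ near $(x_0,t_0)$ and $\varphi(x_0,t_0)=u(x_0,t_0)$, one has at $(x_0,t_0)$: $F(x_0,t_0,\varphi,\nabla\varphi,\nabla^2\varphi)-\varphi_t\le F(x_0,t_0,v,\nabla v,\nabla^2v)-v_t$. *)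

theory Defs
  imports "HOL-Analysis.Analysis"
begin

section \<open>Functions of class \<open>C\<^sup>2\<close>\<close>

definition pd :: "'a::euclidean_space \<Rightarrow> ('a \<Rightarrow> real) \<Rightarrow> 'a \<Rightarrow> real" where
  "pd e f x = frechet_derivative f (at x) e"

definition grad :: "('a::euclidean_space \<Rightarrow> real) \<Rightarrow> 'a \<Rightarrow> 'a" where
  "grad f x = (\<Sum>b\<in>Basis. pd b f x *\<^sub>R b)"

text \<open>Meant for open \<open>U\<close>.\<close>

definition C2_on :: "'a::euclidean_space set \<Rightarrow> ('a \<Rightarrow> real) \<Rightarrow> bool" where
  "C2_on U f \<longleftrightarrow>
     (\<forall>x\<in>U. f differentiable at x) \<and>
     (\<forall>e. \<forall>x\<in>U. pd e f differentiable at x) \<and>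
     (\<forall>d e. continuous_on U (pd d (pd e f)))"

text \<open>Extension of \<open>g\<close> from an open set \<open>D\<close> to its closure by limits from inside \<open>D\<close>.
  It ignores the values of \<open>g\<close> outside \<open>D\<close>, which carry no information when \<open>g\<close> is a
  derivative of a function that is meaningful on the closure of \<open>D\<close> only.\<close>

definition clext :: "'a::euclidean_space set \<Rightarrow> ('a \<Rightarrow> real) \<Rightarrow> 'a \<Rightarrow> real" where
  "clext D g x = (if x \<in> D then g x else Lim (at x within D) g)"

text \<open>The class \<open>C\<^sup>2\<close> of the closure of an open set \<open>D\<close>: the function is \<open>C\<^sup>2\<close> in \<open>D\<close> and all
  derivatives up to order two extend continuously to the closure.\<close>

definition C2_on_closure :: "'a::euclidean_space set \<Rightarrow> ('a \<Rightarrow> real) \<Rightarrow> bool" where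
  "C2_on_closure D f \<longleftrightarrow>
     C2_on D f \<and>
     continuous_on (closure D) f \<and>
     (\<forall>e. continuous_on (closure D) (clext D (pd e f))) \<and>
     (\<forall>d e. continuous_on (closure D) (clext D (pd d (pd e f))))"

definition lsc_on :: "'a::topological_space set \<Rightarrow> ('a \<Rightarrow> real) \<Rightarrow> bool" where
  "lsc_on S f \<longleftrightarrow> (\<forall>a. openin (top_of_set S) {x \<in> S. a < f x})"


section \<open>The nonlinear operator\<close>

text \<open>Points of space-time are pairs \<open>(x, t)\<close>.\<close>

type_synonym 'n spt = "(real ^ 'n) \<times> real"

text \<open>The arguments are \<open>(x, t)\<close>, \<open>s\<close>, \<open>p\<close>, \<open>M\<close>. Only values at points of the closure of the domain
  and at symmetric \<open>M\<close> are meaningful.\<close>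

type_synonym 'n nlop = "'n spt \<Rightarrow> real \<Rightarrow> real ^ 'n \<Rightarrow> real ^ 'n ^ 'n \<Rightarrow> real"

definition sym_matrices :: "(real ^ 'n ^ 'n) set" where
  "sym_matrices = {M. transpose M = M}"

definition positive_definite :: "real ^ 'n ^ 'n \<Rightarrow> bool" where
  "positive_definite A \<longleftrightarrow> transpose A = A \<and> (\<forall>\<xi>. \<xi> \<noteq> 0 \<longrightarrow> \<xi> \<bullet> (A *v \<xi>) > 0)"

text \<open>The symmetrised matrix unit \<open>(E\<^sub>i\<^sub>j + E\<^sub>j\<^sub>i) / 2\<close>.\<close>

definition sym_unit :: "'n \<Rightarrow> 'n \<Rightarrow> real ^ 'n ^ 'n" where
  "sym_unit i j = (\<chi> a b. ((if a = i \<and> b = j then 1 else 0) + (if a = j \<and> b = i then 1 else 0)) / 2)"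

definition deriv_s :: "'n::finite nlop \<Rightarrow> 'n spt \<Rightarrow> real \<Rightarrow> real ^ 'n \<Rightarrow> real ^ 'n ^ 'n \<Rightarrow> real" where
  "deriv_s F z s p M = deriv (\<lambda>r. F z r p M) s"

definition deriv_p ::
    "'n::finite nlop \<Rightarrow> 'n spt \<Rightarrow> real \<Rightarrow> real ^ 'n \<Rightarrow> real ^ 'n ^ 'n \<Rightarrow> real ^ 'n" where
  "deriv_p F z s p M = (\<chi> i. deriv (\<lambda>h. F z s (p + h *\<^sub>R axis i 1) M) 0)"

text \<open>Since \<open>F\<close> lives on symmetric matrices, its derivative with respect to \<open>M\<^sub>i\<^sub>j\<close> is taken along
  the symmetrised matrix unit. This is the usual convention: the differential of \<open>F\<close> in \<open>M\<close> is then
  \<open>N \<mapsto> \<Sum>i j. F\<^sub>M\<^sub>i\<^sub>j N\<^sub>i\<^sub>j\<close> with \<open>(F\<^sub>M\<^sub>i\<^sub>j)\<close> symmetric, without a factor 2 off the diagonal.\<close>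

definition deriv_M ::
    "'n::finite nlop \<Rightarrow> 'n spt \<Rightarrow> real \<Rightarrow> real ^ 'n \<Rightarrow> real ^ 'n ^ 'n \<Rightarrow> real ^ 'n ^ 'n" where
  "deriv_M F z s p M = (\<chi> i j. deriv (\<lambda>h. F z s p (M + h *\<^sub>R sym_unit i j)) 0)"

definition C1_in_spM :: "'n::finite spt set \<Rightarrow> 'n nlop \<Rightarrow> bool" where
  "C1_in_spM K F \<longleftrightarrow>
     (\<forall>z\<in>K. \<forall>s p. \<forall>M\<in>sym_matrices.
        (\<lambda>r. F z r p M) field_differentiable at s \<and>
        (\<forall>i. (\<lambda>h. F z s (p + h *\<^sub>R axis i 1) M) field_differentiable at 0) \<and>
        (\<forall>i j. (\<lambda>h. F z s p (M + h *\<^sub>R sym_unit i j)) field_differentiable at 0)) \<and>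
     continuous_on (K \<times> UNIV \<times> UNIV \<times> sym_matrices) (\<lambda>(z, s, p, M). deriv_s F z s p M) \<and>
     continuous_on (K \<times> UNIV \<times> UNIV \<times> sym_matrices) (\<lambda>(z, s, p, M). deriv_p F z s p M) \<and>
     continuous_on (K \<times> UNIV \<times> UNIV \<times> sym_matrices) (\<lambda>(z, s, p, M). deriv_M F z s p M)"

text \<open>Derivatives in \<open>x\<close> and \<open>t\<close> of a function on the open set \<open>D\<close>, continued to boundary points of \<open>D\<close>.\<close>

definition xgrad :: "'n::finite spt set \<Rightarrow> ('n spt \<Rightarrow> real) \<Rightarrow> 'n spt \<Rightarrow> real ^ 'n" where
  "xgrad D w z = (\<chi> i. clext D (pd (axis i 1, 0) w) z)"

definition xhess :: "'n::finite spt set \<Rightarrow> ('n spt \<Rightarrow> real) \<Rightarrow> 'n spt \<Rightarrow> real ^ 'n ^ 'n" where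
  "xhess D w z = (\<chi> i j. clext D (pd (axis i 1, 0) (pd (axis j 1, 0) w)) z)"

definition tderiv :: "'n::finite spt set \<Rightarrow> ('n spt \<Rightarrow> real) \<Rightarrow> 'n spt \<Rightarrow> real" where
  "tderiv D w z = clext D (pd (0, 1) w) z"

text \<open>The value of \<open>F(x, t, w, \<nabla>w, \<nabla>\<^sup>2w) - w\<^sub>t\<close> at \<open>z = (x, t)\<close>.\<close>

definition parabolic_op ::
    "'n::finite nlop \<Rightarrow> 'n spt set \<Rightarrow> ('n spt \<Rightarrow> real) \<Rightarrow> 'n spt \<Rightarrow> real" where
  "parabolic_op F D w z = F z (w z) (xgrad D w z) (xhess D w z) - tderiv D w z"

text \<open>\<open>F(x, t, u, \<nabla>u, \<nabla>\<^sup>2u) - u\<^sub>t \<le> F(x, t, v, \<nabla>v, \<nabla>\<^sup>2v) - v\<^sub>t\<close> on \<open>\<Omega> \<union> S\<close> in the viscosity sense.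
  Test functions live on a full neighbourhood \<open>U\<close> of \<open>z0\<close>, but are compared with \<open>u\<close> on \<open>\<Omega> \<union> S\<close> only;
  the derivatives of \<open>v\<close> at points of \<open>S\<close> are those continued from \<open>\<Omega>\<close>.\<close>

definition viscosity_le ::
    "'n::finite nlop \<Rightarrow> 'n spt set \<Rightarrow> 'n spt set \<Rightarrow> ('n spt \<Rightarrow> real) \<Rightarrow> ('n spt \<Rightarrow> real) \<Rightarrow> bool" where
  "viscosity_le F \<Omega> S u v \<longleftrightarrow>
     (\<forall>z0 \<in> \<Omega> \<union> S. \<forall>U \<phi>.
        open U \<and> z0 \<in> U \<and> C2_on U \<phi> \<and> (\<forall>z \<in> U \<inter> (\<Omega> \<union> S). \<phi> z \<le> u z) \<and> \<phi> z0 = u z0 \<longrightarrow>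
        parabolic_op F U \<phi> z0 \<le> parabolic_op F \<Omega> v z0)"


section \<open>The domain and its boundary\<close>

definition time_zero :: "'n::finite spt set" where
  "time_zero = {z. snd z = 0}"

definition rel_boundary :: "'n::finite spt set \<Rightarrow> 'n spt set" where
  "rel_boundary S = (top_of_set time_zero) frontier_of S"

definition parabolic_boundary :: "'n::finite spt set \<Rightarrow> 'n spt set \<Rightarrow> 'n spt set" where
  "parabolic_boundary \<Omega> S = frontier \<Omega> - S"

text \<open>Near \<open>p\<close> the boundary of \<open>A\<close> is a \<open>C\<^sup>2\<close> hypersurface \<open>{\<tau> = 0}\<close> with \<open>A\<close> on the side \<open>{\<tau> > 0}\<close>,
  and \<open>m\<close> is the inner unit normal at \<open>p\<close>.\<close>

definition C2_boundary_near :: "'a::euclidean_space set \<Rightarrow> 'a \<Rightarrow> 'a \<Rightarrow> bool" where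
  "C2_boundary_near A p m \<longleftrightarrow>
     (\<exists>U \<tau>. open U \<and> p \<in> U \<and> C2_on U \<tau> \<and> (\<forall>x\<in>U. grad \<tau> x \<noteq> 0) \<and>
        A \<inter> U = {x \<in> U. \<tau> x > 0} \<and> frontier A \<inter> U = {x \<in> U. \<tau> x = 0} \<and>
        p \<in> frontier A \<and> m = sgn (grad \<tau> p))"

text \<open>Near \<open>p\<close> the parabolic boundary is a \<open>C\<^sup>2\<close> hypersurface \<open>{\<rho> = 0, \<sigma> \<ge> 0}\<close> with boundary
  \<open>{\<rho> = 0, \<sigma> = 0}\<close>, the latter being the relative boundary of \<open>S\<close>; the domain lies on the side
  \<open>{\<rho> > 0}\<close> of it, and \<open>m\<close> is the interior unit normal at \<open>p\<close>. One-sidedness is only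
  required at points off the edge: which points near the edge itself belong to \<open>\<Omega>\<close> cannot be read
  off the sign of \<open>\<rho>\<close>, since \<open>{\<rho> = 0}\<close> continues past the edge. The surface is not assumed
  to be transversal to \<open>{t = 0}\<close>.\<close>

definition C2_parabolic_boundary_near ::
    "'n::finite spt set \<Rightarrow> 'n spt set \<Rightarrow> 'n spt \<Rightarrow> 'n spt \<Rightarrow> bool" where
  "C2_parabolic_boundary_near \<Omega> S p m \<longleftrightarrow>
     (\<exists>U \<rho> \<sigma>. open U \<and> p \<in> U \<and> C2_on U \<rho> \<and> C2_on U \<sigma> \<and>
        (\<forall>z\<in>U. \<forall>a b. a *\<^sub>R grad \<rho> z + b *\<^sub>R grad \<sigma> z = 0 \<longrightarrow> a = 0 \<and> b = 0) \<and>
        parabolic_boundary \<Omega> S \<inter> U = {z \<in> U. \<rho> z = 0 \<and> \<sigma> z \<ge> 0} \<and>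
        rel_boundary S \<inter> U = {z \<in> U. \<rho> z = 0 \<and> \<sigma> z = 0} \<and>
        (\<forall>z \<in> parabolic_boundary \<Omega> S \<inter> U - rel_boundary S.
           \<forall>\<^sub>F w in nhds z. w \<in> \<Omega> \<longleftrightarrow> \<rho> w > 0 \<and> snd w < 0) \<and>
        m = sgn (grad \<rho> p))"

end

theory Submission
  imports Defs
begin

text \<open>
  The proof is Hopf's comparison with a barrier. It needs a ball with the origin on its sphere, whose
  part in \<open>{t \<le> 0}\<close> lies in \<open>\<Omega> \<union> S\<close> apart from the origin, and whose centre \<open>m / 2\<close> satisfies
  \<open>\<nu> \<bullet> m > 0\<close>. Then \<open>q(z) = z \<bullet> m - z \<bullet> z\<close> is positive inside the ball, vanishes on its sphere,
  and grows linearly along \<open>\<nu>\<close>, so that the estimate \<open>u - v \<ge> \<epsilon> q\<close> near the origin gives the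
  positive lower limit.

  The ball (lemma \<open>interior_ball_at_corner\<close>). With \<open>{\<rho> = 0, \<sigma> \<ge> 0}\<close> the parabolic boundary,
  take \<open>m\<close> proportional to \<open>\<rho>\<^sub>\<nu> \<nabla>\<rho>(0)\<close> if the derivative \<open>\<rho>\<^sub>\<nu>\<close> of \<open>\<rho>\<close> at \<open>0\<close> along \<open>\<nu>\<close> is
  nonzero, and to \<open>- \<nabla>\<sigma>(0)\<close> otherwise; in both cases \<open>z \<bullet> m \<le> C |z|\<^sup>2\<close> on the parabolic boundary,
  so a small multiple of \<open>m\<close> gives a ball that avoids it. The lower half of the ball is connected, meets
  \<open>\<Omega>\<close> (below points of \<open>S\<close>) and misses the frontier of \<open>\<Omega>\<close>, hence is contained in \<open>\<Omega>\<close>. In the second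
  case the surface is tangent to \<open>{t = 0}\<close>, its normal is \<open>(0, -1)\<close>, and \<open>\<nabla>\<sigma>(0) \<bullet> \<nu>\<close> is
  negative: otherwise the surface would extend beneath \<open>S\<close> with \<open>\<Omega>\<close> on both sides of it.

  The barrier (lemma \<open>barrier_strict_subsolution_near_zero\<close>). With the coefficients of the linearised
  operator frozen at the origin, \<open>h = q + K q\<^sup>2\<close> is a strict subsolution near \<open>0\<close> for large \<open>K\<close>: the term
  \<open>2 K \<nabla>q \<otimes> \<nabla>q\<close> of the Hessian dominates because the \<open>x\<close>-part of \<open>m = \<nabla>q(0)\<close> is nonzero and
  the second-order coefficients are positive definite. Replacing true increments of \<open>F\<close> by the frozen
  linear ones costs an arbitrarily small multiple of their size (lemma
  \<open>operator_increment_lower_bound\<close>).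

  The comparison (lemma \<open>growth_from_interior_ball\<close>). If \<open>u - v - \<epsilon> h\<close> had a negative minimum over
  the part of the ball near \<open>0\<close>, it would be attained at a point of \<open>\<Omega> \<union> S\<close> inside the ball, and
  there \<open>v + \<epsilon> h\<close> plus a constant touches \<open>u\<close> from below. As \<open>v\<close> has no \<open>C\<^sup>2\<close> extension across \<open>S\<close> at
  hand, the test function is its second-order Taylor polynomial with a slightly lowered Hessian; the
  viscosity inequality for it contradicts the strict subsolution property. The
  zeroth-order term is harmless whatever its sign, because \<open>0 \<le> u - v < \<epsilon> h\<close> at that point and \<open>h\<close>
  is small near the origin.
\<close>

section \<open>Directional derivatives and Taylor estimates\<close>

lemma has_derivative_pd:
  assumes "f differentiable at x"
  shows "(f has_derivative (\<lambda>y. pd y f x)) (at x)"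
  using assms by (simp add: pd_def frechet_derivative_works)

lemma pd_eqI:
  assumes "(f has_derivative f') (at x)"
  shows "pd e f x = f' e"
  unfolding pd_def using frechet_derivative_at[OF assms] by metis

lemma pd_basis_expansion:
  assumes "f differentiable at x"
  shows "pd y f x = (\<Sum>b\<in>Basis. (y \<bullet> b) * pd b f x)"
proof -
  have lin: "linear (\<lambda>y. pd y f x)"
    using has_derivative_linear[OF has_derivative_pd[OF assms]] .
  have "pd y f x = pd (\<Sum>b\<in>Basis. (y \<bullet> b) *\<^sub>R b) f x"
    by (simp add: euclidean_representation)
  also have "\<dots> = (\<Sum>b\<in>Basis. (y \<bullet> b) * pd b f x)"
    by (simp add: linear_sum[OF lin] linear_cmul[OF lin])
  finally show ?thesis .
qed

lemma pd_eq_inner_grad: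
  assumes "f differentiable at x"
  shows "pd y f x = y \<bullet> grad f x"
  by (simp add: pd_basis_expansion[OF assms, of y] grad_def inner_sum_right mult.commute)

lemma has_real_derivative_along_line:
  assumes "f differentiable at (x + t *\<^sub>R y)"
  shows "((\<lambda>s. f (x + s *\<^sub>R y)) has_real_derivative pd y f (x + t *\<^sub>R y)) (at t)"
proof -
  have lin: "linear (\<lambda>e. pd e f (x + t *\<^sub>R y))"
    using has_derivative_linear[OF has_derivative_pd[OF assms]] .
  have "((\<lambda>s. x + s *\<^sub>R y) has_derivative (\<lambda>s. s *\<^sub>R y)) (at t)"
    by (auto intro!: derivative_eq_intros)
  from has_derivative_compose[OF this has_derivative_pd[OF assms]]
  show ?thesis
    by (simp add: has_field_derivative_def linear_cmul[OF lin] mult.commute[of _ "pd y f _"])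
qed

lemma mean_value_along_line:
  assumes "\<And>t. 0 \<le> t \<Longrightarrow> t \<le> 1 \<Longrightarrow> f differentiable at (x + t *\<^sub>R y)"
  obtains t where "0 < t" "t < 1" "f (x + y) - f x = pd y f (x + t *\<^sub>R y)"
proof -
  have "\<exists>t>0. t < 1 \<and> f (x + 1 *\<^sub>R y) - f (x + 0 *\<^sub>R y) = (1 - 0) * pd y f (x + t *\<^sub>R y)"
    by (rule MVT2) (auto intro!: has_real_derivative_along_line assms)
  then show ?thesis using that by auto
qed

lemma pd_diff_translate:
  assumes "f differentiable at (x + a)" "f differentiable at x"
  shows "(\<lambda>x. f (x + a) - f x) differentiable at x"
    "pd d (\<lambda>x. f (x + a) - f x) x = pd d f (x + a) - pd d f x"
proof -
  have "((\<lambda>x. x + a) has_derivative (\<lambda>y. y)) (at x)"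
    by (auto intro!: derivative_eq_intros)
  from has_derivative_diff[OF has_derivative_compose[OF this has_derivative_pd[OF assms(1)]]
      has_derivative_pd[OF assms(2)]]
  have D: "((\<lambda>x. f (x + a) - f x) has_derivative (\<lambda>y. pd y f (x + a) - pd y f x)) (at x)" .
  then show "(\<lambda>x. f (x + a) - f x) differentiable at x"
    by (auto simp: differentiable_def)
  show "pd d (\<lambda>x. f (x + a) - f x) x = pd d f (x + a) - pd d f x"
    by (rule pd_eqI[OF D])
qed

text \<open>The mean value theorem, first for the difference \<open>z \<mapsto> f (z + e) - f z\<close> along \<open>d\<close> and then for
  \<open>pd d f\<close> along \<open>e\<close>. The left-hand side is symmetric in \<open>d\<close> and \<open>e\<close>, which yields the symmetry of
  second derivatives below.\<close>

lemma second_difference_mean_value: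
  assumes C2: "C2_on (ball x r) f" and r: "norm d + norm e < r"
  obtains y where "norm (y - x) \<le> norm d + norm e"
    "f (x + d + e) - f (x + d) - f (x + e) + f x = pd e (pd d f) y"
proof -
  have inball: "x + t *\<^sub>R d + s *\<^sub>R e \<in> ball x r" and
       nrm: "norm (t *\<^sub>R d + s *\<^sub>R e) \<le> norm d + norm e"
    if "0 \<le> t" "t \<le> 1" "0 \<le> s" "s \<le> 1" for t s
  proof -
    have "norm (t *\<^sub>R d + s *\<^sub>R e) \<le> norm (t *\<^sub>R d) + norm (s *\<^sub>R e)" by (rule norm_triangle_ineq)
    also have "\<dots> \<le> norm d + norm e" using that by (intro add_mono) (auto simp: mult_left_le_one_le)
    finally show "norm (t *\<^sub>R d + s *\<^sub>R e) \<le> norm d + norm e" .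
    moreover have "dist x (x + t *\<^sub>R d + s *\<^sub>R e) = norm (t *\<^sub>R d + s *\<^sub>R e)"
      by (metis add.assoc add_diff_cancel_left' dist_commute dist_norm)
    ultimately show "x + t *\<^sub>R d + s *\<^sub>R e \<in> ball x r" using r by simp
  qed
  have df: "f differentiable at z" if "z \<in> ball x r" for z using C2 that by (auto simp: C2_on_def)
  have dpf: "pd d f differentiable at z" if "z \<in> ball x r" for z using C2 that by (auto simp: C2_on_def)
  define g where "g z = f (z + e) - f z" for z
  have dg: "g differentiable at (x + t *\<^sub>R d)"
     "pd d g (x + t *\<^sub>R d) = pd d f (x + t *\<^sub>R d + e) - pd d f (x + t *\<^sub>R d)" if "0 \<le> t" "t \<le> 1" for t
    unfolding g_def
    using inball[OF that, of 1] inball[OF that, of 0] by (auto intro!: pd_diff_translate df)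
  obtain t where t: "0 < t" "t < 1" "g (x + d) - g x = pd d g (x + t *\<^sub>R d)"
    by (rule mean_value_along_line[of g x d]) (auto intro: dg)
  obtain s where s: "0 < s" "s < 1"
     "pd d f (x + t *\<^sub>R d + e) - pd d f (x + t *\<^sub>R d) = pd e (pd d f) (x + t *\<^sub>R d + s *\<^sub>R e)"
    by (rule mean_value_along_line[of "pd d f" "x + t *\<^sub>R d" e])
       (use t in \<open>auto intro!: dpf inball\<close>)
  have "f (x + d + e) - f (x + d) - f (x + e) + f x = pd e (pd d f) (x + t *\<^sub>R d + s *\<^sub>R e)"
    using t(3) s(3) dg(2)[of t] t(1,2) unfolding g_def by linarith
  moreover have "norm (x + t *\<^sub>R d + s *\<^sub>R e - x) \<le> norm d + norm e"
    using nrm[of t s] t s by (simp add: add.assoc)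
  ultimately show ?thesis using that by blast
qed

lemma C2_on_subset: "C2_on U f \<Longrightarrow> V \<subseteq> U \<Longrightarrow> C2_on V f"
  unfolding C2_on_def by (meson continuous_on_subset subsetD)

lemma pd_scale: "f differentiable at x \<Longrightarrow> pd (c *\<^sub>R d) f x = c * pd d f x"
  using linear_cmul[OF has_derivative_linear[OF has_derivative_pd], of f x c d] by simp

text \<open>Schwarz's theorem. Both second derivatives are limits of the same second difference quotient, so
  continuity at \<open>x\<close> forces them to agree. The Hessian of \<open>v\<close> has to be symmetric because \<open>F\<close> is
  controlled at symmetric matrices only.\<close>

lemma pd_commute:
  assumes U: "open U" "x \<in> U" and C2: "C2_on U f"
  shows "pd e (pd d f) x = pd d (pd e f) x"
proof (rule ccontr)
  assume ne: "pd e (pd d f) x \<noteq> pd d (pd e f) x"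
  define \<omega> where "\<omega> = \<bar>pd e (pd d f) x - pd d (pd e f) x\<bar> / 2"
  have \<omega>: "\<omega> > 0" using ne by (simp add: \<omega>_def)
  obtain r0 where r0: "r0 > 0" "ball x r0 \<subseteq> U" using U open_contains_ball by blast
  have cont: "\<exists>\<delta>>0. \<forall>z. norm (z - x) < \<delta> \<longrightarrow> \<bar>pd a (pd b f) z - pd a (pd b f) x\<bar> < \<omega>" for a b
  proof -
    have "continuous_on U (pd a (pd b f))" using C2 by (simp add: C2_on_def)
    then have "isCont (pd a (pd b f)) x" using U continuous_on_eq_continuous_at by blast
    then show ?thesis using \<omega>
      by (auto simp: continuous_at_eps_delta dist_norm dist_real_def)
  qed
  obtain \<delta>1 where \<delta>1: "\<delta>1 > 0" "\<And>z. norm (z - x) < \<delta>1 \<Longrightarrow> \<bar>pd e (pd d f) z - pd e (pd d f) x\<bar> < \<omega>"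
    using cont by blast
  obtain \<delta>2 where \<delta>2: "\<delta>2 > 0" "\<And>z. norm (z - x) < \<delta>2 \<Longrightarrow> \<bar>pd d (pd e f) z - pd d (pd e f) x\<bar> < \<omega>"
    using cont by blast
  define r where "r = min r0 (min \<delta>1 \<delta>2)"
  have r: "r > 0" using r0 \<delta>1 \<delta>2 by (simp add: r_def)
  define s where "s = r / (2 * (norm d + norm e + 1))"
  have pos: "norm d + norm e + 1 > 0" by (simp add: add_nonneg_pos)
  have s: "s > 0" using r pos by (simp add: s_def)
  have small: "norm (s *\<^sub>R d) + norm (s *\<^sub>R e) < r"
  proof -
    have "norm (s *\<^sub>R d) + norm (s *\<^sub>R e) = s * (norm d + norm e)" using s by (simp add: algebra_simps)
    also have "\<dots> < s * (2 * (norm d + norm e + 1))" using s by (simp add: add_strict_increasing2 add_nonneg_pos)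
    also have "\<dots> = r" using pos by (simp add: s_def)
    finally show ?thesis .
  qed
  have C2r: "C2_on (ball x r) f" 
    using r0 by (intro C2_on_subset[OF C2]) (auto simp: r_def)
  have sc: "pd (s *\<^sub>R a) (pd (s *\<^sub>R b) f) y = s * s * pd a (pd b f) y" if y: "y \<in> ball x r" for a b y
  proof -
    have D: "pd b f differentiable at y" using C2r y by (simp add: C2_on_def)
    have "((\<lambda>z. s * pd b f z) has_derivative (\<lambda>h. s * pd h (pd b f) y)) (at y)"
      by (intro has_derivative_mult_right has_derivative_pd D)
    then have "(pd (s *\<^sub>R b) f has_derivative (\<lambda>h. s * pd h (pd b f) y)) (at y)"
      by (rule has_derivative_transform_within_open[OF _ open_ball y])
         (use C2r in \<open>simp add: pd_scale C2_on_def\<close>)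
    from pd_eqI[OF this] show ?thesis using pd_scale[OF D] by simp
  qed
  obtain y1 where y1: "norm (y1 - x) < r"
    "f (x + s *\<^sub>R d + s *\<^sub>R e) - f (x + s *\<^sub>R d) - f (x + s *\<^sub>R e) + f x = s * s * pd e (pd d f) y1"
  proof -
    obtain y where y: "norm (y - x) \<le> norm (s *\<^sub>R d) + norm (s *\<^sub>R e)"
      "f (x + s *\<^sub>R d + s *\<^sub>R e) - f (x + s *\<^sub>R d) - f (x + s *\<^sub>R e) + f x = pd (s *\<^sub>R e) (pd (s *\<^sub>R d) f) y"
      using second_difference_mean_value[OF C2r small] .
    with small that[of y] sc[of y] show ?thesis by (simp add: dist_norm norm_minus_commute)
  qed
  obtain y2 where y2: "norm (y2 - x) < r"
    "f (x + s *\<^sub>R e + s *\<^sub>R d) - f (x + s *\<^sub>R e) - f (x + s *\<^sub>R d) + f x = s * s * pd d (pd e f) y2"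
  proof -
    have small': "norm (s *\<^sub>R e) + norm (s *\<^sub>R d) < r" using small by simp
    obtain y where y: "norm (y - x) \<le> norm (s *\<^sub>R e) + norm (s *\<^sub>R d)"
      "f (x + s *\<^sub>R e + s *\<^sub>R d) - f (x + s *\<^sub>R e) - f (x + s *\<^sub>R d) + f x = pd (s *\<^sub>R d) (pd (s *\<^sub>R e) f) y"
      using second_difference_mean_value[OF C2r small'] .
    with small' that[of y] sc[of y] show ?thesis by (simp add: dist_norm norm_minus_commute)
  qed
  have "x + s *\<^sub>R e + s *\<^sub>R d = x + s *\<^sub>R d + s *\<^sub>R e" by (simp add: algebra_simps)
  then have "f (x + s *\<^sub>R e + s *\<^sub>R d) = f (x + s *\<^sub>R d + s *\<^sub>R e)" by (rule arg_cong)
  then have "s * s * pd d (pd e f) y2 = s * s * pd e (pd d f) y1" using y1(2) y2(2) by linarith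
  then have "pd d (pd e f) y2 = pd e (pd d f) y1" using s by simp
  moreover have "\<bar>pd e (pd d f) y1 - pd e (pd d f) x\<bar> < \<omega>" "\<bar>pd d (pd e f) y2 - pd d (pd e f) x\<bar> < \<omega>"
    using \<delta>1 \<delta>2 y1 y2 by (auto simp: r_def)
  ultimately show False by (simp add: \<omega>_def abs_if split: if_splits)
qed

text \<open>The mean value theorem together with the differentiability of the partial derivatives at \<open>0\<close>, which
  bounds their increments by a multiple of \<open>norm z\<close>.\<close>

lemma first_order_expansion_at_zero:
  fixes f :: "'a::euclidean_space \<Rightarrow> real"
  assumes U: "open U" "0 \<in> U" and C2: "C2_on U f" and f0: "f 0 = 0"
  obtains C r where "C > 0" "r > 0" "\<And>z. norm z < r \<Longrightarrow> \<bar>f z - z \<bullet> grad f 0\<bar> \<le> C * (norm z)\<^sup>2"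
proof -
  have bd: "\<exists>C>0. \<exists>r>0. \<forall>z. norm z < r \<longrightarrow> \<bar>pd b f z - pd b f 0\<bar> \<le> C * norm z" for b
  proof -
    have D: "pd b f differentiable at 0" using C2 U by (simp add: C2_on_def)
    obtain L where L: "(pd b f has_derivative L) (at 0)" using D by (auto simp: differentiable_def)
    obtain B where B: "B > 0" "\<And>z. norm (L z) \<le> B * norm z"
      using has_derivative_bounded_linear[OF L] bounded_linear.pos_bounded by (metis mult.commute)
    obtain r where r: "r > 0" "\<And>z. norm (z - 0) < r \<Longrightarrow> norm (pd b f z - pd b f 0 - L (z - 0)) \<le> 1 * norm (z - 0)"
      using L unfolding has_derivative_at_alt by (metis zero_less_one)
    have "\<bar>pd b f z - pd b f 0\<bar> \<le> (B + 1) * norm z" if "norm z < r" for z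
      using r(2)[of z] B(2)[of z] that by (auto simp: algebra_simps)
    then show ?thesis using B r by (metis add_pos_pos zero_less_one)
  qed
  obtain C r where Cr: "\<And>b. C b > 0" "\<And>b. r b > 0" 
     "\<And>b z. norm z < r b \<Longrightarrow> \<bar>pd b f z - pd b f 0\<bar> \<le> C b * norm z"
    using bd by metis
  obtain r0 where r0: "r0 > 0" "ball 0 r0 \<subseteq> U" using U open_contains_ball by blast
  define R where "R = Min (insert r0 (r ` Basis))"
  have R: "R > 0" "R \<le> r0" "\<And>b. b \<in> Basis \<Longrightarrow> R \<le> r b"
    unfolding R_def using r0 Cr by (auto simp del: Min_insert intro!: Min_le)
  have "\<bar>f z - z \<bullet> grad f 0\<bar> \<le> (sum C Basis) * (norm z)\<^sup>2" if z: "norm z < R" for z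
  proof -
    have inU: "t *\<^sub>R z \<in> U" if "0 \<le> t" "t \<le> 1" for t
    proof -
      have "norm (t *\<^sub>R z) \<le> norm z" using that by (auto simp: mult_left_le_one_le)
      then show ?thesis using z R r0 by (auto simp: subset_eq dist_norm)
    qed
    have df: "f differentiable at y" if "y \<in> U" for y using C2 that by (simp add: C2_on_def)
    obtain t where t: "0 < t" "t < 1" "f (0 + z) - f 0 = pd z f (0 + t *\<^sub>R z)"
      by (rule mean_value_along_line[of f 0 z]) (auto intro: df inU)
    have "f z - z \<bullet> grad f 0 = pd z f (t *\<^sub>R z) - pd z f 0"
      using t f0 pd_eq_inner_grad[OF df[OF U(2)]] by simp
    also have "\<dots> = (\<Sum>b\<in>Basis. (z \<bullet> b) * (pd b f (t *\<^sub>R z) - pd b f 0))"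
      using pd_basis_expansion[OF df[OF inU[of t]], of z] pd_basis_expansion[OF df[OF U(2)], of z] t
      by (simp add: sum_subtractf algebra_simps)
    also have "\<bar>\<dots>\<bar> \<le> (\<Sum>b\<in>Basis. norm z * (C b * norm z))"
    proof (rule order.trans[OF sum_abs sum_mono])
      fix b :: 'a assume b: "b \<in> Basis"
      have tz: "norm (t *\<^sub>R z) \<le> norm z" using t by (auto simp: mult_left_le_one_le)
      have "\<bar>pd b f (t *\<^sub>R z) - pd b f 0\<bar> \<le> C b * norm (t *\<^sub>R z)"
        using Cr(3)[of "t *\<^sub>R z" b] tz z R(3)[OF b] by linarith
      also have "\<dots> \<le> C b * norm z" using tz Cr(1)[of b] by (simp add: mult_left_mono less_imp_le del: norm_scaleR)
      finally show "\<bar>z \<bullet> b * (pd b f (t *\<^sub>R z) - pd b f 0)\<bar> \<le> norm z * (C b * norm z)"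
        unfolding abs_mult by (intro mult_mono Basis_le_norm b) auto
    qed
    also have "\<dots> = (sum C Basis) * (norm z)\<^sup>2"
      by (simp add: sum_distrib_left power2_eq_square ac_simps)
    finally show ?thesis .
  qed
  moreover have "sum C Basis > 0" using Cr by (intro sum_pos) auto
  ultimately show ?thesis using that R by blast
qed

text \<open>The test functions for the viscosity inequality are of this form; \<open>B\<close> need not be
  self-adjoint, hence the symmetrised second derivative.\<close>

lemma quadratic_derivatives:
  fixes B :: "'a::euclidean_space \<Rightarrow> 'a" and c :: real and l z1 :: 'a
  assumes B: "linear B"
  defines "f \<equiv> \<lambda>z. c + l \<bullet> (z - z1) + ((z - z1) \<bullet> B (z - z1)) / 2"
  shows "C2_on UNIV f"
    "pd e f z = l \<bullet> e + ((z - z1) \<bullet> B e + e \<bullet> B (z - z1)) / 2"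
    "pd d (pd e f) z = (d \<bullet> B e + e \<bullet> B d) / 2"
proof -
  have bl: "bounded_linear B" using B linear_conv_bounded_linear by blast
  note [derivative_intros] = bounded_linear.has_derivative[OF bl]
  have D1: "(f has_derivative (\<lambda>e. l \<bullet> e + ((z - z1) \<bullet> B e + e \<bullet> B (z - z1)) / 2)) (at z)" for z
    unfolding f_def
    by (auto intro!: derivative_eq_intros ext simp: inner_commute)
  show P1: "pd e f z = l \<bullet> e + ((z - z1) \<bullet> B e + e \<bullet> B (z - z1)) / 2" for e z
    by (rule pd_eqI[OF D1])
  have P1': "pd e f = (\<lambda>z. l \<bullet> e + ((z - z1) \<bullet> B e + e \<bullet> B (z - z1)) / 2)" for e
    using P1 by auto
  have D2: "(pd e f has_derivative (\<lambda>d. (d \<bullet> B e + e \<bullet> B d) / 2)) (at z)" for e z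
    unfolding P1' by (auto intro!: derivative_eq_intros ext)
  show P2: "pd d (pd e f) z = (d \<bullet> B e + e \<bullet> B d) / 2" for d e z
    by (rule pd_eqI[OF D2])
  have P2': "pd d (pd e f) = (\<lambda>z. (d \<bullet> B e + e \<bullet> B d) / 2)" for d e
    using P2 by auto
  show "C2_on UNIV f"
    unfolding C2_on_def using D1 D2 by (auto simp: P2' differentiable_def)
qed

text \<open>Taylor's formula on a segment with the Hessian in the remainder replaced by a fixed matrix \<open>H\<close>. Only
  points of the segment are involved, so the lemma can be applied in \<open>\<Omega>\<close> with \<open>H\<close> the Hessian at
  a nearby boundary point.\<close>

lemma second_order_taylor_lower_bound:
  fixes f :: "'a::euclidean_space \<Rightarrow> real"
  assumes U: "open U" and C2: "C2_on U f"
    and seg: "\<And>t. 0 \<le> t \<Longrightarrow> t \<le> 1 \<Longrightarrow> x + t *\<^sub>R y \<in> U"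
    and H: "\<And>t b b'. 0 \<le> t \<Longrightarrow> t \<le> 1 \<Longrightarrow> b \<in> Basis \<Longrightarrow> b' \<in> Basis \<Longrightarrow>
        \<bar>pd b (pd b' f) (x + t *\<^sub>R y) - H b b'\<bar> \<le> \<omega>"
  shows "f (x + y) \<ge> f x + (\<Sum>b\<in>Basis. (y \<bullet> b) * pd b f x)
      + (\<Sum>b\<in>Basis. \<Sum>b'\<in>Basis. (y \<bullet> b) * (y \<bullet> b') * H b b') / 2
      - real (DIM('a) * DIM('a)) * \<omega> * (norm y)\<^sup>2 / 2"
proof -
  define g where "g n t = (case n of 0 \<Rightarrow> f (x + t *\<^sub>R y)
     | Suc 0 \<Rightarrow> (\<Sum>b\<in>Basis. (y \<bullet> b) * pd b f (x + t *\<^sub>R y))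
     | _ \<Rightarrow> (\<Sum>b\<in>Basis. (y \<bullet> b) * (\<Sum>b'\<in>Basis. (y \<bullet> b') * pd b' (pd b f) (x + t *\<^sub>R y))))" for n :: nat and t :: real
  have df: "f differentiable at z" "\<And>b. pd b f differentiable at z" if "z \<in> U" for z
    using C2 that by (auto simp: C2_on_def)
  have "DERIV (g m) t :> g (Suc m) t" if m: "m < 2" and t: "0 \<le> t" "t \<le> 1" for m t
  proof -
    consider "m = 0" | "m = 1" using m by linarith
    then show ?thesis
    proof cases
      case 1
      have "g 0 = (\<lambda>t. f (x + t *\<^sub>R y))" by (auto simp: g_def)
      then show ?thesis using 1 has_real_derivative_along_line[OF df(1)[OF seg[OF t]]]
        pd_basis_expansion[OF df(1)[OF seg[OF t]], of y] by (simp add: g_def)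
    next
      case 2
      have "g 1 = (\<lambda>t. (\<Sum>b\<in>Basis. (y \<bullet> b) * pd b f (x + t *\<^sub>R y)))" by (auto simp: g_def)
      moreover have "DERIV (\<lambda>t. (\<Sum>b\<in>Basis. (y \<bullet> b) * pd b f (x + t *\<^sub>R y))) t :>
         (\<Sum>b\<in>Basis. (y \<bullet> b) * pd y (pd b f) (x + t *\<^sub>R y))"
        by (intro DERIV_sum DERIV_cmult has_real_derivative_along_line df seg t)
      ultimately show ?thesis using 2
        by (simp add: g_def pd_basis_expansion[OF df(2)[OF seg[OF t]], of y] numeral_2_eq_2)
    qed
  qed
  then have DER: "\<forall>m t. m < 2 \<and> 0 \<le> t \<and> t \<le> 1 \<longrightarrow> DERIV (g m) t :> g (Suc m) t"
    by blast
  have "g 0 = (\<lambda>t. f (x + t *\<^sub>R y))" by (auto simp: g_def)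
  from Taylor[OF _ this DER, of 0 1]
  have "\<exists>t. 0 < t \<and> t < 1 \<and>
    f (x + 1 *\<^sub>R y) = (\<Sum>m<2. (g m 0 / fact m) * (1 - 0)^m) + (g 2 t / fact 2) * (1 - 0)^2"
    by simp
  then obtain t where t: "0 < t" "t < 1" "f (x + y) = g 0 0 + g 1 0 + g 2 t / 2"
    by (auto simp: lessThan_Suc numeral_2_eq_2)
  have yb: "\<bar>y \<bullet> b\<bar> \<le> norm y" if "b \<in> Basis" for b using that by (rule Basis_le_norm)
  have "(\<Sum>b\<in>Basis. \<Sum>b'\<in>Basis. (y \<bullet> b) * (y \<bullet> b') * H b b') - g 2 t
      = (\<Sum>b\<in>Basis. \<Sum>b'\<in>Basis. (y \<bullet> b) * (y \<bullet> b') * (H b b' - pd b (pd b' f) (x + t *\<^sub>R y)))"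
    (is "?L = _")
  proof -
    have "g 2 t = (\<Sum>b\<in>Basis. \<Sum>b'\<in>Basis. (y \<bullet> b) * (y \<bullet> b') * pd b' (pd b f) (x + t *\<^sub>R y))"
      by (simp add: g_def numeral_2_eq_2 sum_distrib_left mult.assoc)
    also have "\<dots> = (\<Sum>b\<in>Basis. \<Sum>b'\<in>Basis. (y \<bullet> b) * (y \<bullet> b') * pd b (pd b' f) (x + t *\<^sub>R y))"
      by (subst sum.swap) (simp add: mult.commute mult.left_commute)
    finally show ?thesis by (simp add: sum_subtractf algebra_simps)
  qed
  also have "\<dots> \<le> (\<Sum>b\<in>(Basis::'a set). \<Sum>b'\<in>(Basis::'a set). norm y * norm y * \<omega>)"
  proof (intro sum_mono)
    fix b b' :: 'a assume b: "b \<in> Basis" "b' \<in> Basis"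
    have "(y \<bullet> b) * (y \<bullet> b') * (H b b' - pd b (pd b' f) (x + t *\<^sub>R y))
       \<le> \<bar>(y \<bullet> b) * (y \<bullet> b') * (H b b' - pd b (pd b' f) (x + t *\<^sub>R y))\<bar>" by simp
    also have "\<dots> \<le> norm y * norm y * \<omega>"
      unfolding abs_mult using H[of t b b'] b t yb by (intro mult_mono) auto
    finally show "(y \<bullet> b) * (y \<bullet> b') * (H b b' - pd b (pd b' f) (x + t *\<^sub>R y)) \<le> norm y * norm y * \<omega>" .
  qed
  finally have "?L \<le> real (DIM('a) * DIM('a)) * \<omega> * (norm y)\<^sup>2"
    by (simp add: power2_eq_square algebra_simps)
  then show ?thesis using t by (simp add: g_def numeral_2_eq_2 field_simps)
qed

section \<open>An interior ball at the corner of the domain\<close>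

lemma rel_boundary_eq_closure_minus:
  fixes S :: "'n::finite spt set"
  assumes "openin (top_of_set time_zero) S"
  shows "rel_boundary S = closure S - S"
proof -
  have S: "S \<subseteq> time_zero" using assms openin_imp_subset by blast
  have "closed (time_zero :: 'n spt set)" unfolding time_zero_def
    by (intro closed_Collect_eq continuous_intros)
  then have "closure S \<subseteq> time_zero" using S by (simp add: closure_minimal)
  then show ?thesis using S
    by (simp add: rel_boundary_def frontier_of_def interior_of_openin[OF assms]
        closure_of_subtopology Int_absorb1)
qed

lemma frontier_slice_subset_rel_boundary:
  fixes S :: "'n::finite spt set"
  assumes S: "openin (top_of_set time_zero) S" and x: "x \<in> frontier {x. (x, 0) \<in> S}"
  shows "(x, 0) \<in> rel_boundary S"
proof -
  let ?A = "{x. (x, 0) \<in> S}"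
  obtain T where T: "open T" "S = time_zero \<inter> T" using S by (auto simp: openin_open)
  have "?A = (\<lambda>x. (x, 0)) -` T" using T by (auto simp: time_zero_def)
  moreover have "open ((\<lambda>x. (x, 0::real)) -` T)"
    by (intro open_vimage T continuous_intros)
  ultimately have oA: "open ?A" by simp
  have "(\<lambda>x. (x, 0)) ` closure ?A \<subseteq> closure S"
    by (intro image_closure_subset continuous_intros) (auto intro: subsetD[OF closure_subset])
  moreover have "x \<in> closure ?A" "x \<notin> ?A" using x oA by (auto simp: frontier_def interior_open)
  ultimately show ?thesis by (auto simp: rel_boundary_eq_closure_minus[OF S])
qed

text \<open>Along \<open>s w + a e\<close> the defining function is \<open>a |\<nabla>\<tau>| + O(s\<^sup>2)\<close>, hence changes sign for
  \<open>a\<close> between \<open>- L s\<^sup>2\<close> and \<open>L s\<^sup>2\<close>; the intermediate value theorem gives a boundary point. This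
  replaces a local parametrisation of the boundary.\<close>

lemma C2_boundary_tangent_points:
  fixes A :: "'a::euclidean_space set"
  assumes A: "C2_boundary_near A 0 e" and w: "w \<bullet> e = 0"
  obtains L r where "L > 0" "r > 0"
    "\<And>s. 0 < s \<Longrightarrow> s < r \<Longrightarrow> \<exists>x\<in>frontier A. norm (x - s *\<^sub>R w) \<le> L * s\<^sup>2"
    "\<And>s. 0 < s \<Longrightarrow> s < r \<Longrightarrow> s *\<^sub>R e \<in> A"
proof -
  obtain U \<tau> where U: "open U" "0 \<in> U" "C2_on U \<tau>" "grad \<tau> 0 \<noteq> 0"
      "A \<inter> U = {x \<in> U. \<tau> x > 0}" "frontier A \<inter> U = {x \<in> U. \<tau> x = 0}"
      "0 \<in> frontier A" "e = sgn (grad \<tau> 0)"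
    using A unfolding C2_boundary_near_def by blast
  have \<tau>0: "\<tau> 0 = 0" using U by blast
  have e: "norm e = 1" "e \<bullet> e = 1" using U by (simp_all add: norm_sgn norm_eq_1[symmetric])
  define c where "c = norm (grad \<tau> 0)"
  have c: "c > 0" "grad \<tau> 0 = c *\<^sub>R e" using U by (simp_all add: c_def sgn_div_norm)
  obtain C r1 where C: "C > 0" "r1 > 0" "\<And>z. norm z < r1 \<Longrightarrow> \<bar>\<tau> z - z \<bullet> grad \<tau> 0\<bar> \<le> C * (norm z)\<^sup>2"
    using first_order_expansion_at_zero[OF U(1-3) \<tau>0] by metis
  obtain r2 where r2: "r2 > 0" "ball 0 r2 \<subseteq> U" using U open_contains_ball by blast
  define R where "R = min r1 r2"
  have R: "R > 0" "R \<le> r1" "R \<le> r2" using C r2 by (auto simp: R_def)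
  define L where "L = C * ((norm w)\<^sup>2 + 1) / c"
  have L: "L > 0" "c * L = C * ((norm w)\<^sup>2 + 1)" using C c by (simp_all add: L_def add_nonneg_pos)
  define r where "r = min (1 / L) (min (R / (norm w + 1)) (min R (c / C)))"
  have wpos: "norm w + 1 > 0" by (simp add: add_nonneg_pos)
  have r: "r > 0" using L R C c wpos by (simp add: r_def)
  have "\<exists>x\<in>frontier A. norm (x - s *\<^sub>R w) \<le> L * s\<^sup>2" if s: "0 < s" "s < r" for s
  proof -
    have sL: "L * s \<le> 1" using s L by (simp add: r_def field_simps)
    have sR: "s * (norm w + 1) < R" using s wpos by (simp add: r_def field_simps)
    have near: "norm (s *\<^sub>R w + a *\<^sub>R e) < R" "(norm (s *\<^sub>R w + a *\<^sub>R e))\<^sup>2 \<le> s\<^sup>2 * ((norm w)\<^sup>2 + 1)"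
      if a: "\<bar>a\<bar> \<le> L * s\<^sup>2" for a
    proof -
      have "L * s\<^sup>2 = (L * s) * s" by (simp add: power2_eq_square)
      also have "\<dots> \<le> 1 * s" using sL s by (intro mult_right_mono) auto
      finally have as: "\<bar>a\<bar> \<le> s" using a by simp
      have "norm (s *\<^sub>R w + a *\<^sub>R e) \<le> s * norm w + \<bar>a\<bar>"
        using norm_triangle_ineq[of "s *\<^sub>R w" "a *\<^sub>R e"] s e by simp
      with as sR show "norm (s *\<^sub>R w + a *\<^sub>R e) < R" by (simp add: algebra_simps)
      have "(norm (s *\<^sub>R w + a *\<^sub>R e))\<^sup>2 = s\<^sup>2 * (norm w)\<^sup>2 + a\<^sup>2"
        unfolding power2_norm_eq_inner
        using w e by (simp add: inner_add_left inner_add_right inner_commute power2_eq_square)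
      moreover have "a\<^sup>2 \<le> s\<^sup>2" using as s by (metis abs_le_square_iff abs_of_pos)
      ultimately show "(norm (s *\<^sub>R w + a *\<^sub>R e))\<^sup>2 \<le> s\<^sup>2 * ((norm w)\<^sup>2 + 1)" by (simp add: algebra_simps)
    qed
    have inU: "s *\<^sub>R w + a *\<^sub>R e \<in> U" if "\<bar>a\<bar> \<le> L * s\<^sup>2" for a
      using near(1)[OF that] R r2 by (auto simp: subset_eq)
    have val: "\<bar>\<tau> (s *\<^sub>R w + a *\<^sub>R e) - a * c\<bar> \<le> (c * L) * s\<^sup>2" if a: "\<bar>a\<bar> \<le> L * s\<^sup>2" for a
    proof -
      have "(s *\<^sub>R w + a *\<^sub>R e) \<bullet> grad \<tau> 0 = a * c" using w e by (simp add: c(2) inner_add_left)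
      then have "\<bar>\<tau> (s *\<^sub>R w + a *\<^sub>R e) - a * c\<bar> \<le> C * (norm (s *\<^sub>R w + a *\<^sub>R e))\<^sup>2"
        using C(3)[of "s *\<^sub>R w + a *\<^sub>R e"] near(1)[OF a] R by simp
      also have "\<dots> \<le> C * (s\<^sup>2 * ((norm w)\<^sup>2 + 1))" using near(2)[OF a] C(1) by simp
      finally show ?thesis unfolding L(2) by (simp add: mult_ac)
    qed
    have Ls: "0 < L * s\<^sup>2" using L s by simp
    have "\<exists>a\<ge>- (L * s\<^sup>2). a \<le> L * s\<^sup>2 \<and> \<tau> (s *\<^sub>R w + a *\<^sub>R e) = 0"
    proof (rule IVT')
      show "\<tau> (s *\<^sub>R w + (- (L * s\<^sup>2)) *\<^sub>R e) \<le> 0" "0 \<le> \<tau> (s *\<^sub>R w + (L * s\<^sup>2) *\<^sub>R e)"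
        using val[of "- (L * s\<^sup>2)"] val[of "L * s\<^sup>2"] Ls by (simp_all add: abs_le_iff algebra_simps)
      show "- (L * s\<^sup>2) \<le> L * s\<^sup>2" using Ls by simp
      have "continuous_on U \<tau>" using U(3)
        by (auto simp: C2_on_def continuous_on_eq_continuous_within differentiable_imp_continuous_within
            intro: continuous_at_imp_continuous_within)
      then show "continuous_on {- (L * s\<^sup>2)..L * s\<^sup>2} (\<lambda>a. \<tau> (s *\<^sub>R w + a *\<^sub>R e))"
        by (rule continuous_on_compose2) (auto intro!: continuous_intros inU)
    qed
    then obtain a where a: "\<bar>a\<bar> \<le> L * s\<^sup>2" "\<tau> (s *\<^sub>R w + a *\<^sub>R e) = 0"
      unfolding abs_le_iff by (metis minus_le_iff)
    then have "s *\<^sub>R w + a *\<^sub>R e \<in> frontier A" using U(6) inU by blast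
    moreover have "norm (s *\<^sub>R w + a *\<^sub>R e - s *\<^sub>R w) \<le> L * s\<^sup>2" using a e by simp
    ultimately show ?thesis by blast
  qed
  moreover have "s *\<^sub>R e \<in> A" if s: "0 < s" "s < r" for s
  proof -
    have sR: "norm (s *\<^sub>R e) < R" using s e by (simp add: r_def)
    have "\<bar>\<tau> (s *\<^sub>R e) - s * c\<bar> \<le> C * s\<^sup>2"
      using C(3)[of "s *\<^sub>R e"] sR R e s by (simp add: c(2) mult.commute[of c])
    moreover have "C * s < c" using s C by (simp add: r_def field_simps)
    then have "C * s\<^sup>2 < s * c" using s by (simp add: power2_eq_square)
    ultimately have "\<tau> (s *\<^sub>R e) > 0" by linarith
    moreover have "s *\<^sub>R e \<in> U" using sR R r2 by (auto simp: subset_eq)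
    ultimately show ?thesis using U(5) by blast
  qed
  ultimately show ?thesis using that[of L r] L r by blast
qed

lemma grad_orthogonal_to_tangent:
  fixes f :: "'a::euclidean_space \<Rightarrow> real"
  assumes U: "open U" "0 \<in> U" "C2_on U f" "f 0 = 0"
    and r: "r > 0" and L: "L > 0"
    and pts: "\<And>s. 0 < s \<Longrightarrow> s < r \<Longrightarrow> \<exists>x. f x = 0 \<and> norm (x - s *\<^sub>R w) \<le> L * s\<^sup>2"
  shows "w \<bullet> grad f 0 = 0"
proof (rule ccontr)
  assume ne: "w \<bullet> grad f 0 \<noteq> 0"
  obtain C r1 where C: "C > 0" "r1 > 0" "\<And>z. norm z < r1 \<Longrightarrow> \<bar>f z - z \<bullet> grad f 0\<bar> \<le> C * (norm z)\<^sup>2"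
    using first_order_expansion_at_zero[OF U] by metis
  define D where "D = C * (norm w + 1)\<^sup>2 + L * norm (grad f 0)"
  have wpos: "norm w + 1 > 0" by (simp add: add_nonneg_pos)
  have D: "D > 0" unfolding D_def using C L wpos by (intro add_pos_nonneg) auto
  have "0 < min r (min (1 / L) (min (r1 / (norm w + 1)) (\<bar>w \<bullet> grad f 0\<bar> / D)))"
    using r L C ne D wpos by simp
  then obtain s where "0 < s" "s < min r (min (1 / L) (min (r1 / (norm w + 1)) (\<bar>w \<bullet> grad f 0\<bar> / D)))"
    using dense by blast
  then have s: "0 < s" "s < r" "L * s < 1" "s * (norm w + 1) < r1" "s * D < \<bar>w \<bullet> grad f 0\<bar>"
    using pos_less_divide_eq[OF L, of s 1] pos_less_divide_eq[OF wpos, of s r1]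
      pos_less_divide_eq[OF D, of s "\<bar>w \<bullet> grad f 0\<bar>"]
    by (simp_all add: mult.commute[of L s])
  obtain x where x: "f x = 0" "norm (x - s *\<^sub>R w) \<le> L * s\<^sup>2" using pts s by blast
  have "L * s\<^sup>2 = (L * s) * s" by (simp add: power2_eq_square)
  also have "\<dots> \<le> 1 * s" using s by (intro mult_right_mono) auto
  finally have "norm (x - s *\<^sub>R w) \<le> s" using x by simp
  then have nx: "norm x \<le> s * (norm w + 1)"
    using norm_triangle_sub[of x "s *\<^sub>R w"] s by (simp add: algebra_simps)
  have "\<bar>x \<bullet> grad f 0\<bar> \<le> C * (norm x)\<^sup>2" using C(3)[of x] nx s x by simp
  also have "\<dots> \<le> C * (s * (norm w + 1))\<^sup>2" using nx C by (intro mult_left_mono power_mono) auto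
  finally have 1: "\<bar>x \<bullet> grad f 0\<bar> \<le> s * (s * (C * (norm w + 1)\<^sup>2))" by (simp add: power2_eq_square ac_simps)
  have "\<bar>(x - s *\<^sub>R w) \<bullet> grad f 0\<bar> \<le> norm (x - s *\<^sub>R w) * norm (grad f 0)" by (rule Cauchy_Schwarz_ineq2)
  also have "\<dots> \<le> (L * s\<^sup>2) * norm (grad f 0)" using x by (intro mult_right_mono) auto
  finally have "\<bar>(x - s *\<^sub>R w) \<bullet> grad f 0\<bar> \<le> s * (s * (L * norm (grad f 0)))"
    by (simp add: power2_eq_square ac_simps)
  with 1 have "\<bar>s * (w \<bullet> grad f 0)\<bar> \<le> s * (s * (C * (norm w + 1)\<^sup>2)) + s * (s * (L * norm (grad f 0)))"
    by (simp add: inner_diff_left)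
  also have "\<dots> = s * (s * D)" by (simp add: D_def algebra_simps)
  finally have "\<bar>w \<bullet> grad f 0\<bar> \<le> s * D" using s by (simp add: abs_mult)
  then show False using s by simp
qed

lemma connected_avoiding_frontier:
  assumes "connected W" "W \<inter> frontier \<Omega> = {}" "W \<inter> \<Omega> \<noteq> {}"
  shows "W \<subseteq> \<Omega>"
  using connected_Int_frontier[OF assms(1,3)] assms(2) by blast

lemma snd_le_zero_of_closure:
  assumes "\<Omega> \<subseteq> {z. snd z < (0::real)}" "z \<in> closure \<Omega>"
  shows "snd z \<le> 0"
proof -
  have "closed {z :: 'a::topological_space \<times> real. snd z \<le> 0}" by (intro closed_Collect_le continuous_intros)
  then have "closure \<Omega> \<subseteq> {z. snd z \<le> 0}" using assms by (intro closure_minimal) auto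
  then show ?thesis using assms by auto
qed

text \<open>Suppose that \<open>\<nabla>\<sigma>(0) \<bullet> (e, 0) > 0\<close>. Below the point \<open>(s e, 0)\<close> of \<open>S\<close> the vertical line meets
  \<open>{\<rho> = 0}\<close> at a time \<open>t0 = O(s\<^sup>2)\<close>, with \<open>\<sigma> > 0\<close> there, so at a point of the parabolic boundary and
  with \<open>t0 < 0\<close>. Between the two points \<open>\<rho>\<close> is negative and the frontier is absent. By one-sidedness
  the line is outside \<open>\<Omega>\<close> just above \<open>t0\<close>, but it is inside \<open>\<Omega>\<close> just below \<open>S\<close>.\<close>

lemma tangential_parabolic_boundary_points_outward:
  fixes \<Omega> S :: "'n::finite spt set"
  assumes \<Omega>: "\<Omega> \<subseteq> {z. snd z < 0}" and S: "S \<subseteq> time_zero" "S \<subseteq> frontier \<Omega>"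
    and U: "open U" "0 \<in> U" and C2: "C2_on U \<rho>" "C2_on U \<sigma>" and zero: "\<rho> 0 = 0" "\<sigma> 0 = 0"
    and PB: "parabolic_boundary \<Omega> S \<inter> U = {z \<in> U. \<rho> z = 0 \<and> \<sigma> z \<ge> 0}"
    and side: "\<And>z. z \<in> parabolic_boundary \<Omega> S \<inter> U \<Longrightarrow> snd z \<noteq> 0 \<Longrightarrow>
           \<forall>\<^sub>F w in nhds z. w \<in> \<Omega> \<longleftrightarrow> \<rho> w > 0 \<and> snd w < 0"
    and e: "norm e = 1" and r: "r > 0" "\<And>s. 0 < s \<Longrightarrow> s < r \<Longrightarrow> (s *\<^sub>R e, 0) \<in> S"
    and \<rho>e: "(e, 0) \<bullet> grad \<rho> 0 = 0" and \<rho>t: "(0, 1) \<bullet> grad \<rho> 0 < 0"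
  shows "(e, 0) \<bullet> grad \<sigma> 0 \<le> 0"
proof (rule ccontr)
  define c where "c = (e, 0) \<bullet> grad \<sigma> 0"
  assume "\<not> (e, 0) \<bullet> grad \<sigma> 0 \<le> 0"
  then have c: "c > 0" by (simp add: c_def)
  define b where "b = - ((0, 1) \<bullet> grad \<rho> 0)"
  have b: "b > 0" using \<rho>t by (simp add: b_def)
  define d where "d = (0, 1) \<bullet> grad \<sigma> 0"
  obtain C1 r1 where C1: "C1 > 0" "r1 > 0" "\<And>z. norm z < r1 \<Longrightarrow> \<bar>\<rho> z - z \<bullet> grad \<rho> 0\<bar> \<le> C1 * (norm z)\<^sup>2"
    using first_order_expansion_at_zero[OF U C2(1) zero(1)] by metis
  obtain C2' r2 where C2': "C2' > 0" "r2 > 0" "\<And>z. norm z < r2 \<Longrightarrow> \<bar>\<sigma> z - z \<bullet> grad \<sigma> 0\<bar> \<le> C2' * (norm z)\<^sup>2"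
    using first_order_expansion_at_zero[OF U C2(2) zero(2)] by metis
  have df: "\<rho> differentiable at z" if "z \<in> U" for z using C2 that by (auto simp: C2_on_def)
  obtain r3 where r3: "r3 > 0" "ball 0 r3 \<subseteq> U" "\<And>z. norm z < r3 \<Longrightarrow> pd (0, 1) \<rho> z < 0"
  proof -
    obtain r0 where r0: "r0 > 0" "ball 0 r0 \<subseteq> U" using U open_contains_ball by blast
    have "pd (0, 1) \<rho> differentiable at 0" using C2(1) U by (simp add: C2_on_def)
    then have "isCont (pd (0, 1) \<rho>) 0" by (rule differentiable_imp_continuous_within)
    moreover have "pd (0, 1) \<rho> 0 < 0" using \<rho>t pd_eq_inner_grad[OF df[OF U(2)]] by metis
    ultimately obtain r0' where r0': "r0' > 0" "\<And>z. norm z < r0' \<Longrightarrow> \<bar>pd (0, 1) \<rho> z - pd (0, 1) \<rho> 0\<bar> < - pd (0, 1) \<rho> 0"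
      by (auto simp: continuous_at_eps_delta dist_norm dest!: spec[of _ "- pd (0, 1) \<rho> 0"])
    have "pd (0, 1) \<rho> z < 0" if "norm z < r0'" for z using r0'(2)[OF that] by linarith
    moreover have "ball 0 (min r0 r0') \<subseteq> U" using r0(2) by (simp add: subset_eq)
    ultimately show thesis using that[of "min r0 r0'"] r0(1) r0'(1) by (metis min_less_iff_conj)
  qed
  define K where "K = (2 * C1 + 1) / b"
  have K: "K > 0" "b * K = 2 * C1 + 1" using C1 b by (simp_all add: K_def add_pos_pos)
  have den: "\<bar>d\<bar> * K + 2 * C2' > 0" using C2' K by (simp add: add_nonneg_pos)
  have "0 < min r (min (1 / K) (min (r1 / 2) (min (r2 / 2) (min (r3 / 2) (c / (\<bar>d\<bar> * K + 2 * C2'))))))"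
    using r K C1 C2' r3 c den by simp
  then obtain s where "0 < s" "s < min r (min (1 / K) (min (r1 / 2) (min (r2 / 2) (min (r3 / 2) (c / (\<bar>d\<bar> * K + 2 * C2'))))))"
    using dense by blast
  then have s': "s < r" "s < 1 / K" "2 * s < r1" "2 * s < r2" "2 * s < r3" "s < c / (\<bar>d\<bar> * K + 2 * C2')"
    and s0: "0 < s" unfolding min_less_iff_conj by linarith+
  have "s * K < 1" using pos_less_divide_eq[OF K(1), of s 1] s'(2) by blast
  then have s: "0 < s" "s < r" "K * s < 1" "2 * s < r1" "2 * s < r2" "2 * s < r3"
      "s * (\<bar>d\<bar> * K + 2 * C2') < c"
    using s0 s' pos_less_divide_eq[OF den, of s c] by (auto simp only: mult.commute[of K s])
  \<comment> \<open>Half-length of the vertical segment on which \<open>\<rho>\<close> is known to change sign.\<close>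
  define T where "T = K * s\<^sup>2"
  have T: "T > 0" "T \<le> s"
  proof -
    show "T > 0" using K s by (simp add: T_def)
    have "T = (K * s) * s" by (simp add: T_def power2_eq_square)
    also have "\<dots> \<le> 1 * s" using s by (intro mult_right_mono) auto
    finally show "T \<le> s" by simp
  qed
  have nrm2: "(norm (s *\<^sub>R e, t))\<^sup>2 \<le> 2 * s\<^sup>2" and nrm: "norm (s *\<^sub>R e, t) \<le> 2 * s" if t: "\<bar>t\<bar> \<le> T" for t
  proof -
    have "t\<^sup>2 \<le> s\<^sup>2" using t T s by (metis abs_le_square_iff abs_of_pos order.trans)
    then show *: "(norm (s *\<^sub>R e, t))\<^sup>2 \<le> 2 * s\<^sup>2"
      using e s by (simp add: norm_Pair)
    show "norm (s *\<^sub>R e, t) \<le> 2 * s"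
      by (rule power2_le_imp_le[OF order.trans[OF *]]) (use s in \<open>auto simp: power2_eq_square\<close>)
  qed
  have inU: "(s *\<^sub>R e, t) \<in> U" if t: "\<bar>t\<bar> \<le> T" for t
    using nrm[OF t] s r3 by (auto simp: subset_eq)
  have inner_split: "(s *\<^sub>R e, t) \<bullet> g = s * ((e, 0) \<bullet> g) + t * ((0, 1) \<bullet> g)" for g :: "'n spt" and t
    by (cases g) simp
  have \<rho>val: "\<bar>\<rho> (s *\<^sub>R e, t) + b * t\<bar> \<le> 2 * C1 * s\<^sup>2" if t: "\<bar>t\<bar> \<le> T" for t
  proof -
    have "\<bar>\<rho> (s *\<^sub>R e, t) + b * t\<bar> \<le> C1 * (norm (s *\<^sub>R e, t))\<^sup>2"
      using C1(3)[of "(s *\<^sub>R e, t)"] nrm[OF t] s \<rho>e by (simp add: inner_split b_def algebra_simps)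
    also have "\<dots> \<le> C1 * (2 * s\<^sup>2)" using nrm2[OF t] C1 by (intro mult_left_mono) auto
    finally show ?thesis by simp
  qed
  \<comment> \<open>On the segment \<open>\<rho>\<close> is strictly decreasing in time, so its zero is unique and \<open>\<rho> < 0\<close> above it.\<close>
  have decr: "\<rho> (s *\<^sub>R e, t2) < \<rho> (s *\<^sub>R e, t1)" if t: "- T \<le> t1" "t1 < t2" "t2 \<le> T" for t1 t2
  proof (rule DERIV_neg_imp_decreasing[OF t(2)])
    fix t assume "t1 \<le> t" "t \<le> t2"
    then have tT: "\<bar>t\<bar> \<le> T" using t by auto
    have "((\<lambda>t. \<rho> ((s *\<^sub>R e, 0) + t *\<^sub>R (0, 1))) has_real_derivative pd (0, 1) \<rho> ((s *\<^sub>R e, 0) + t *\<^sub>R (0, 1))) (at t)"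
      by (intro has_real_derivative_along_line df) (use inU[OF tT] in auto)
    moreover have "pd (0, 1) \<rho> (s *\<^sub>R e, t) < 0" using r3(3) nrm[OF tT] s by auto
    ultimately show "\<exists>y. ((\<lambda>t. \<rho> (s *\<^sub>R e, t)) has_real_derivative y) (at t) \<and> y < 0" by auto
  qed
  have cont\<rho>: "continuous_on U \<rho>" using df
    by (auto simp: continuous_on_eq_continuous_within differentiable_imp_continuous_within
            intro: continuous_at_imp_continuous_within)
  have "\<exists>t\<ge>- T. t \<le> T \<and> \<rho> (s *\<^sub>R e, t) = 0"
  proof (rule IVT2')
    have "b * T = (b * K) * s\<^sup>2" by (simp add: T_def)
    then have "b * T = 2 * C1 * s\<^sup>2 + s\<^sup>2" unfolding K(2) by (simp add: distrib_right)
    then show "\<rho> (s *\<^sub>R e, T) \<le> 0" "0 \<le> \<rho> (s *\<^sub>R e, - T)"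
      using \<rho>val[of T] \<rho>val[of "- T"] T(1) zero_le_power2[of s]
      unfolding abs_le_iff mult_minus_right by linarith+
    show "- T \<le> T" using T by simp
    show "continuous_on {- T..T} (\<lambda>t. \<rho> (s *\<^sub>R e, t))"
      by (rule continuous_on_compose2[OF cont\<rho>]) (auto intro!: continuous_intros inU)
  qed
  then obtain t0 where t0: "\<bar>t0\<bar> \<le> T" "\<rho> (s *\<^sub>R e, t0) = 0"
    unfolding abs_le_iff by (metis minus_le_iff)
  let ?z = "(s *\<^sub>R e, t0)"
  have "\<sigma> ?z > 0"
  proof -
    have "\<bar>\<sigma> ?z - (s * c + t0 * d)\<bar> \<le> C2' * (norm ?z)\<^sup>2"
      using C2'(3)[of ?z] nrm[OF t0(1)] s by (simp add: inner_split c_def d_def)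
    also have "\<dots> \<le> C2' * (2 * s\<^sup>2)" using nrm2[OF t0(1)] C2' by (intro mult_left_mono) auto
    finally have "\<sigma> ?z \<ge> s * c + t0 * d - 2 * C2' * s\<^sup>2" by (simp add: abs_le_iff)
    moreover have "\<bar>t0 * d\<bar> \<le> T * \<bar>d\<bar>" unfolding abs_mult using t0 by (intro mult_right_mono) auto
    moreover have "s * (s * (\<bar>d\<bar> * K + 2 * C2')) < s * c" using s by simp
    then have "T * \<bar>d\<bar> + 2 * C2' * s\<^sup>2 < s * c" by (simp add: T_def power2_eq_square algebra_simps)
    ultimately show ?thesis by linarith
  qed
  then have zPB: "?z \<in> parabolic_boundary \<Omega> S \<inter> U" using PB inU[OF t0(1)] t0 by auto
  have pS: "(s *\<^sub>R e, 0) \<in> S" using r s by simp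
  have "t0 \<le> 0" using snd_le_zero_of_closure[OF \<Omega>, of ?z] zPB by (auto simp: parabolic_boundary_def frontier_def)
  moreover have "t0 \<noteq> 0" using zPB pS by (auto simp: parabolic_boundary_def)
  ultimately have t0neg: "t0 < 0" by simp
  have noF: "z \<notin> frontier \<Omega>" if "z \<in> U" "\<rho> z < 0" "snd z < 0" for z
    using that PB S by (force simp: parabolic_boundary_def time_zero_def)
  define Q where "Q = (\<lambda>t. (s *\<^sub>R e, t)) ` {t0<..<0}"
  have conQ: "connected Q" unfolding Q_def by (intro connected_continuous_image continuous_intros) auto
  have Qneg: "\<rho> (s *\<^sub>R e, t) < 0" "(s *\<^sub>R e, t) \<in> U" if "t0 < t" "t \<le> 0" for t
    using decr[of t0 t] inU[of t] t0 that T by auto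
  have QF: "Q \<inter> frontier \<Omega> = {}" using noF Qneg by (fastforce simp: Q_def)
  have Qout: "Q \<inter> \<Omega> = {}"
  proof (rule ccontr)
    assume "Q \<inter> \<Omega> \<noteq> {}"
    from connected_avoiding_frontier[OF conQ QF this] have Q\<Omega>: "Q \<subseteq> \<Omega>" .
    have "\<forall>\<^sub>F w in nhds ?z. w \<in> \<Omega> \<longleftrightarrow> \<rho> w > 0 \<and> snd w < 0" using side[OF zPB] t0neg by simp
    then obtain \<eta> where \<eta>: "\<eta> > 0" "\<And>w. dist w ?z < \<eta> \<Longrightarrow> w \<in> \<Omega> \<Longrightarrow> \<rho> w > 0"
      by (auto simp: eventually_nhds_metric)
    define t where "t = t0 + min (\<eta> / 2) (- t0 / 2)"
    have t: "t0 < t" "t < 0" "dist (s *\<^sub>R e, t) ?z < \<eta>"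
      using \<eta> t0neg by (auto simp: t_def dist_Pair_Pair dist_real_def)
    then have "(s *\<^sub>R e, t) \<in> \<Omega>" using Q\<Omega> by (auto simp: Q_def)
    then show False using \<eta>(2)[OF t(3)] Qneg[of t] t by simp
  qed
  let ?p = "(s *\<^sub>R e, 0::real)"
  have "open {z \<in> U. \<rho> z < 0}"
  proof -
    have "{z \<in> U. \<rho> z < 0} = U \<inter> \<rho> -` {..<0}" by blast
    then show ?thesis using continuous_open_preimage[OF cont\<rho> U(1) open_lessThan[of 0]] by (simp only:)
  qed
  moreover have "?p \<in> {z \<in> U. \<rho> z < 0}" using Qneg[OF t0neg order.refl] by blast
  ultimately obtain \<eta> where \<eta>: "\<eta> > 0" "ball ?p \<eta> \<subseteq> {z \<in> U. \<rho> z < 0}"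
    unfolding open_contains_ball by blast
  define H where "H = ball ?p \<eta> \<inter> {z. snd z < 0}"
  have "convex {z :: 'n spt. snd z < 0}"
    by (rule convexI) (auto simp: add_neg_neg mult_pos_neg intro: convex_bound_lt)
  then have conH: "connected H" unfolding H_def by (intro convex_connected convex_Int convex_ball)
  have HF: "H \<inter> frontier \<Omega> = {}" using noF \<eta> by (auto simp: H_def)
  have "?p \<in> closure \<Omega>" using pS S by (auto simp: frontier_def)
  then obtain y where "y \<in> \<Omega>" "dist y ?p < \<eta>" using \<eta> by (meson closure_approachable)
  then have "H \<inter> \<Omega> \<noteq> {}" using \<Omega> by (auto simp: H_def dist_commute)
  from connected_avoiding_frontier[OF conH HF this] have H\<Omega>: "H \<subseteq> \<Omega>" .
  define t where "t = max (- \<eta> / 2) (t0 / 2)"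
  have "(s *\<^sub>R e, t) \<in> H" "(s *\<^sub>R e, t) \<in> Q"
    using \<eta> t0neg by (auto simp: H_def Q_def t_def dist_Pair_Pair dist_real_def)
  then show False using H\<Omega> Qout by blast
qed


lemma fst_parallel_of_orthogonal:
  fixes g :: "'n::finite spt" and e :: "real ^ 'n"
  assumes e: "norm e = 1" and orth: "\<And>w. w \<bullet> e = 0 \<Longrightarrow> (w, 0) \<bullet> g = 0"
  shows "fst g = ((e, 0) \<bullet> g) *\<^sub>R e"
proof -
  have ee: "e \<bullet> e = 1" using e by (simp add: norm_eq_1)
  define w where "w = fst g - (fst g \<bullet> e) *\<^sub>R e"
  have we: "w \<bullet> e = 0" by (simp add: w_def inner_diff_left ee)
  have "w \<bullet> w = w \<bullet> fst g - (fst g \<bullet> e) * (w \<bullet> e)"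
    by (subst (2) w_def) (simp only: inner_diff_right inner_scaleR_right)
  also have "\<dots> = w \<bullet> fst g" by (simp add: we)
  also have "\<dots> = (w, 0) \<bullet> g" by (cases g) simp
  finally have "w = 0" using orth[OF we] by simp
  then show ?thesis by (cases g) (simp add: w_def inner_commute)
qed

text \<open>The tangent cone of the parabolic boundary at \<open>0\<close> is \<open>{z. z \<bullet> \<nabla>\<rho> = 0, z \<bullet> \<nabla>\<sigma> \<ge> 0}\<close>, and any
  \<open>m = a \<nabla>\<rho> - b \<nabla>\<sigma>\<close> with \<open>b \<ge> 0\<close> is nonpositive on it. Among these, one is chosen
  with a positive component along \<open>e\<close>, which is what makes \<open>z \<bullet> m - z \<bullet> z\<close> grow along the inner
  normal of \<open>S\<close>.\<close>

lemma parabolic_boundary_below_paraboloid: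
  fixes \<Omega> S :: "'n::finite spt set"
  assumes \<Omega>: "\<Omega> \<subseteq> {z. snd z < 0}" and S: "openin (top_of_set time_zero) S" "S \<subseteq> frontier \<Omega>"
    and rim: "C2_boundary_near {x. (x, 0) \<in> S} 0 e"
    and lateral: "C2_parabolic_boundary_near \<Omega> S 0 N" and N: "N \<noteq> (0, 1)"
    and zero: "0 \<in> rel_boundary S"
  obtains m C r where "(e, 0) \<bullet> m > 0" "C > 0" "r > 0"
    "\<And>z. z \<in> parabolic_boundary \<Omega> S \<Longrightarrow> norm z < r \<Longrightarrow> z \<bullet> m \<le> C * (norm z)\<^sup>2"
proof -
  have ST: "S \<subseteq> time_zero" using S openin_imp_subset by blast
  obtain U \<rho> \<sigma> where U: "open U" "0 \<in> U" and C2: "C2_on U \<rho>" "C2_on U \<sigma>"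
    and indep: "\<forall>z\<in>U. \<forall>a b. a *\<^sub>R grad \<rho> z + b *\<^sub>R grad \<sigma> z = 0 \<longrightarrow> a = 0 \<and> b = 0"
    and PB: "parabolic_boundary \<Omega> S \<inter> U = {z \<in> U. \<rho> z = 0 \<and> \<sigma> z \<ge> 0}"
    and RB: "rel_boundary S \<inter> U = {z \<in> U. \<rho> z = 0 \<and> \<sigma> z = 0}"
    and side: "\<forall>z \<in> parabolic_boundary \<Omega> S \<inter> U - rel_boundary S.
           \<forall>\<^sub>F w in nhds z. w \<in> \<Omega> \<longleftrightarrow> \<rho> w > 0 \<and> snd w < 0"
    and Neq: "N = sgn (grad \<rho> 0)"
    using lateral unfolding C2_parabolic_boundary_near_def by (elim exE conjE) (rule that)
  have zeros: "\<rho> 0 = 0" "\<sigma> 0 = 0" using RB U zero by auto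
  have e: "norm e = 1" using rim by (auto simp: C2_boundary_near_def norm_sgn)
  have RBt: "snd z = 0" if "z \<in> rel_boundary S" for z
  proof -
    have "closed (time_zero :: 'n spt set)" unfolding time_zero_def
      by (intro closed_Collect_eq continuous_intros)
    then have "closure S \<subseteq> time_zero" using ST by (simp add: closure_minimal)
    then show ?thesis using that by (auto simp: rel_boundary_eq_closure_minus[OF S(1)] time_zero_def)
  qed
  \<comment> \<open>The rim of \<open>S\<close> lies in \<open>{\<rho> = \<sigma> = 0}\<close>, so both gradients are orthogonal to its tangent vectors.\<close>
  have tangent: "(w, 0) \<bullet> grad \<rho> 0 = 0 \<and> (w, 0) \<bullet> grad \<sigma> 0 = 0" if w: "w \<bullet> e = 0" for w
  proof -
    obtain L r where L: "L > 0" "r > 0"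
      "\<And>s. 0 < s \<Longrightarrow> s < r \<Longrightarrow> \<exists>x\<in>frontier {x. (x, 0) \<in> S}. norm (x - s *\<^sub>R w) \<le> L * s\<^sup>2"
      using C2_boundary_tangent_points[OF rim w] by metis
    obtain r0 where r0: "r0 > 0" "ball 0 r0 \<subseteq> U" using U open_contains_ball by blast
    define r' where "r' = min r (min (1 / L) (r0 / (norm w + 1)))"
    have wpos: "norm w + 1 > 0" by (simp add: add_nonneg_pos)
    have r': "r' > 0" using L r0 wpos by (simp add: r'_def)
    have "\<exists>z. \<rho> z = 0 \<and> \<sigma> z = 0 \<and> norm (z - s *\<^sub>R (w, 0)) \<le> L * s\<^sup>2" if s: "0 < s" "s < r'" for s
    proof -
      obtain x where x: "x \<in> frontier {x. (x, 0) \<in> S}" "norm (x - s *\<^sub>R w) \<le> L * s\<^sup>2"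
        using L(3) s by (auto simp: r'_def)
      have "L * s\<^sup>2 = (L * s) * s" by (simp add: power2_eq_square)
      also have "\<dots> \<le> 1 * s" using s L by (intro mult_right_mono) (auto simp: r'_def field_simps)
      finally have "norm x \<le> s * (norm w + 1)"
        using x norm_triangle_sub[of x "s *\<^sub>R w"] s by (simp add: algebra_simps)
      also have "\<dots> < r0" using s wpos by (simp add: r'_def field_simps)
      finally have "(x, 0) \<in> U" using r0 by (auto simp: subset_eq norm_Pair)
      moreover have "(x, 0) \<in> rel_boundary S" by (rule frontier_slice_subset_rel_boundary[OF S(1) x(1)])
      ultimately show ?thesis using RB x by (intro exI[of _ "(x, 0)"]) (auto simp: norm_Pair)
    qed
    then show ?thesis
      using grad_orthogonal_to_tangent[OF U C2(1) zeros(1) r' L(1), of "(w, 0)"]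
        grad_orthogonal_to_tangent[OF U C2(2) zeros(2) r' L(1), of "(w, 0)"] by blast
  qed
  obtain C1 r1 where C1: "C1 > 0" "r1 > 0" "\<And>z. norm z < r1 \<Longrightarrow> \<bar>\<rho> z - z \<bullet> grad \<rho> 0\<bar> \<le> C1 * (norm z)\<^sup>2"
    using first_order_expansion_at_zero[OF U C2(1) zeros(1)] by metis
  obtain C2' r2 where C2': "C2' > 0" "r2 > 0" "\<And>z. norm z < r2 \<Longrightarrow> \<bar>\<sigma> z - z \<bullet> grad \<sigma> 0\<bar> \<le> C2' * (norm z)\<^sup>2"
    using first_order_expansion_at_zero[OF U C2(2) zeros(2)] by metis
  obtain r0 where r0: "r0 > 0" "ball 0 r0 \<subseteq> U" using U open_contains_ball by blast
  define a where "a = (e, 0) \<bullet> grad \<rho> 0"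
  define c where "c = (e, 0) \<bullet> grad \<sigma> 0"
  have g\<rho>: "fst (grad \<rho> 0) = a *\<^sub>R e" and g\<sigma>: "fst (grad \<sigma> 0) = c *\<^sub>R e"
    unfolding a_def c_def using tangent by (auto intro!: fst_parallel_of_orthogonal[OF e])
  show thesis
  proof (cases "a = 0")
    case False
    show thesis
    proof (rule that[of "a *\<^sub>R grad \<rho> 0" "\<bar>a\<bar> * C1" "min r0 r1"])
      show "0 < (e, 0) \<bullet> a *\<^sub>R grad \<rho> 0" using False by (simp add: a_def[symmetric] zero_less_mult_iff linorder_neq_iff disj_commute)
      show "z \<bullet> a *\<^sub>R grad \<rho> 0 \<le> \<bar>a\<bar> * C1 * (norm z)\<^sup>2"
        if z: "z \<in> parabolic_boundary \<Omega> S" "norm z < min r0 r1" for z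
      proof -
        have "z \<in> U" using z r0 by (auto simp: subset_eq)
        then have "\<rho> z = 0" using PB z by auto
        then have "\<bar>z \<bullet> grad \<rho> 0\<bar> \<le> C1 * (norm z)\<^sup>2" using C1(3)[of z] z by simp
        then have "\<bar>a\<bar> * \<bar>z \<bullet> grad \<rho> 0\<bar> \<le> \<bar>a\<bar> * (C1 * (norm z)\<^sup>2)" by (intro mult_left_mono) auto
        then show ?thesis by (simp add: abs_mult[symmetric] abs_le_iff mult.assoc)
      qed
    qed (use False C1 r0 in auto)
  next
    case True
    define b where "b = (0, 1) \<bullet> grad \<rho> 0"
    have \<rho>eq: "grad \<rho> 0 = (0, b)" using g\<rho> True by (cases "grad \<rho> 0") (simp add: b_def)
    have "b \<noteq> 0" using bspec[OF indep U(2), rule_format, of 1 0] \<rho>eq by (auto simp: zero_prod_def)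
    moreover have "\<not> b > 0"
    proof
      assume "b > 0"
      then have "N = (0, 1)" unfolding Neq \<rho>eq by (simp add: sgn_div_norm norm_Pair)
      then show False using N by simp
    qed
    ultimately have b: "b < 0" by simp
    \<comment> \<open>Otherwise both gradients would be vertical, contrary to their linear independence.\<close>
    have cne: "c \<noteq> 0"
    proof
      assume "c = 0"
      then have "grad \<sigma> 0 = (0, snd (grad \<sigma> 0))" using g\<sigma> by (simp add: prod_eq_iff)
      then have "snd (grad \<sigma> 0) *\<^sub>R grad \<rho> 0 + (- b) *\<^sub>R grad \<sigma> 0 = 0"
        unfolding \<rho>eq by (cases "grad \<sigma> 0") (simp add: zero_prod_def)
      with indep U(2) have "- b = 0" by blast
      then show False using b by simp
    qed
    obtain r where r: "r > 0" "\<And>s. 0 < s \<Longrightarrow> s < r \<Longrightarrow> (s *\<^sub>R e, 0) \<in> S"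
      using C2_boundary_tangent_points[OF rim inner_zero_left] by (metis mem_Collect_eq)
    have "c \<le> 0" unfolding c_def
      by (rule tangential_parabolic_boundary_points_outward[OF \<Omega> ST S(2) U C2 zeros PB _ e r])
         (use side RBt True b in \<open>auto simp: a_def b_def\<close>)
    with cne have c: "c < 0" by simp
    show thesis
    proof (rule that[of "- grad \<sigma> 0" "C2'" "min r0 r2"])
      show "0 < (e, 0) \<bullet> - grad \<sigma> 0" using c by (simp add: c_def)
      show "z \<bullet> - grad \<sigma> 0 \<le> C2' * (norm z)\<^sup>2"
        if z: "z \<in> parabolic_boundary \<Omega> S" "norm z < min r0 r2" for z
      proof -
        have "z \<in> U" using z r0 by (auto simp: subset_eq)
        then have "\<sigma> z \<ge> 0" using PB z by auto
        then show ?thesis using C2'(3)[of z] z by (simp add: abs_le_iff)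
      qed
    qed (use C2' r0 in auto)
  qed
qed

text \<open>For small \<open>k\<close> the ball \<open>z \<bullet> z < k (z \<bullet> m0)\<close> misses the parabolic boundary, as
  \<open>z \<bullet> m0 \<le> C |z|\<^sup>2\<close> there. The ball of half that size keeps its closure, without \<open>0\<close>, inside the larger
  open ball; this is how points with \<open>t = 0\<close> are recognised as frontier points, hence as points of
  \<open>S\<close>.\<close>

lemma interior_ball_at_corner:
  fixes \<Omega> S :: "'n::finite spt set"
  assumes \<Omega>: "open \<Omega>" "\<Omega> \<subseteq> {z. snd z < 0}" and S: "openin (top_of_set time_zero) S" "S \<subseteq> frontier \<Omega>"
    and rim: "C2_boundary_near {x. (x, 0) \<in> S} 0 e"
    and lateral: "C2_parabolic_boundary_near \<Omega> S 0 N" and N: "N \<noteq> (0, 1)"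
    and zero: "0 \<in> rel_boundary S"
  obtains m where "(e, 0) \<bullet> m > 0"
    "\<And>z. z \<noteq> 0 \<Longrightarrow> z \<bullet> z \<le> z \<bullet> m \<Longrightarrow> snd z \<le> 0 \<Longrightarrow> z \<in> \<Omega> \<union> S"
proof -
  have ST: "S \<subseteq> time_zero" using S openin_imp_subset by blast
  have e: "norm e = 1" using rim by (auto simp: C2_boundary_near_def norm_sgn)
  obtain m0 C r where m0: "(e, 0) \<bullet> m0 > 0" and C: "C > 0" "r > 0"
    and PB: "\<And>z. z \<in> parabolic_boundary \<Omega> S \<Longrightarrow> norm z < r \<Longrightarrow> z \<bullet> m0 \<le> C * (norm z)\<^sup>2"
    using parabolic_boundary_below_paraboloid[OF \<Omega>(2) S rim lateral N zero] by metis
  have m0ne: "m0 \<noteq> 0" using m0 by auto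
  define k where "k = min (1 / (2 * C)) (r / (2 * norm m0))"
  have k: "k > 0" "k * C < 1" "k * norm m0 < r"
  proof -
    have "k \<le> 1 / (2 * C)" "k \<le> r / (2 * norm m0)" by (simp_all add: k_def)
    then have "k * C \<le> 1 / 2" "k * norm m0 \<le> r / 2" 
      using C m0ne by (simp_all add: pos_le_divide_eq mult.left_commute mult.commute[of k])
    then show "k > 0" "k * C < 1" "k * norm m0 < r" using C m0ne by (auto simp: k_def)
  qed
  define B where "B = {z. z \<bullet> z < z \<bullet> (k *\<^sub>R m0)}"
  have BPB: "B \<inter> parabolic_boundary \<Omega> S = {}"
  proof (intro equals0I, elim IntE)
    fix z assume z: "z \<in> B" "z \<in> parabolic_boundary \<Omega> S"
    have zne: "z \<noteq> 0" using z by (auto simp: B_def)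
    have "norm z * norm z < norm z * (k * norm m0)"
    proof -
      have "norm z * norm z = z \<bullet> z" by (simp add: dot_square_norm power2_eq_square)
      also have "\<dots> < z \<bullet> (k *\<^sub>R m0)" using z by (simp add: B_def)
      also have "\<dots> \<le> norm z * norm (k *\<^sub>R m0)" by (rule norm_cauchy_schwarz)
      finally show ?thesis using k by simp
    qed
    then have "norm z < r" using zne k by simp
    then have "z \<bullet> m0 \<le> C * (norm z)\<^sup>2" using PB z by blast
    then have "k * (z \<bullet> m0) \<le> k * (C * (norm z)\<^sup>2)" using k by (intro mult_left_mono) auto
    also have "\<dots> = (k * C) * (norm z)\<^sup>2" by simp
    also have "\<dots> \<le> 1 * (norm z)\<^sup>2" using k by (intro mult_right_mono) auto
    finally show False using z by (simp add: B_def power2_norm_eq_inner)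
  qed
  define c where "c = (k / 2) *\<^sub>R m0"
  have Bball: "B = ball c (norm c)"
  proof -
    have "z \<in> B \<longleftrightarrow> z \<in> ball c (norm c)" for z
    proof -
      have "z \<in> ball c (norm c) \<longleftrightarrow> (norm (c - z))\<^sup>2 < (norm c)\<^sup>2"
        by (simp add: dist_norm abs_le_square_iff[symmetric] power2_less_imp_less power_strict_mono linorder_not_le[symmetric])
      also have "(norm (c - z))\<^sup>2 = (norm c)\<^sup>2 - 2 * (z \<bullet> c) + z \<bullet> z"
        unfolding power2_norm_eq_inner by (simp add: inner_diff_left inner_diff_right inner_commute)
      finally show ?thesis by (auto simp: B_def c_def)
    qed
    then show ?thesis by blast
  qed
  define W where "W = B \<inter> {z. snd z < 0}"
  have "convex {z :: 'n spt. snd z < 0}"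
    by (rule convexI) (auto simp: add_neg_neg mult_pos_neg intro: convex_bound_lt)
  then have conW: "connected W" unfolding W_def Bball by (intro convex_connected convex_Int convex_ball)
  have WF: "W \<inter> frontier \<Omega> = {}" using BPB ST by (auto simp: W_def parabolic_boundary_def time_zero_def)
  have "W \<inter> \<Omega> \<noteq> {}"
  proof -
    obtain r' where r': "r' > 0" "\<And>s. 0 < s \<Longrightarrow> s < r' \<Longrightarrow> s *\<^sub>R e \<in> {x. (x, 0) \<in> S}"
      using C2_boundary_tangent_points[OF rim inner_zero_left] by metis
    define s where "s = min r' (k * ((e, 0) \<bullet> m0)) / 2"
    have "min r' (k * ((e, 0) \<bullet> m0)) > 0" using r' k m0 by simp
    then have s: "0 < s" "s < r'" "s < k * ((e, 0) \<bullet> m0)" by (auto simp: s_def min_def field_simps)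
    have pS: "(s *\<^sub>R e, 0) \<in> S" using r' s by auto
    have "s * s < s * (k * ((e, 0) \<bullet> m0))" using s by simp
    moreover have "e \<bullet> e = 1" using e by (simp add: norm_eq_1)
    ultimately have "(s *\<^sub>R e, 0) \<in> B" by (cases m0) (simp add: B_def algebra_simps)
    moreover have "open B" by (simp add: Bball)
    moreover have "(s *\<^sub>R e, 0) \<in> closure \<Omega>" using pS S by (auto simp: frontier_def)
    ultimately have "B \<inter> \<Omega> \<noteq> {}" using open_Int_closure_eq_empty by blast
    then show ?thesis using \<Omega> by (auto simp: W_def)
  qed
  from connected_avoiding_frontier[OF conW WF this] have W\<Omega>: "W \<subseteq> \<Omega>" .
  show thesis
  proof (rule that[of "(k / 2) *\<^sub>R m0"])
    show "(e, 0) \<bullet> (k / 2) *\<^sub>R m0 > 0" using m0 k by simp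
    fix z assume z: "z \<noteq> 0" "z \<bullet> z \<le> z \<bullet> (k / 2) *\<^sub>R m0" "snd z \<le> 0"
    have zz: "z \<bullet> z > 0" using z by simp
    have "z \<bullet> k *\<^sub>R m0 = 2 * (z \<bullet> (k / 2) *\<^sub>R m0)" by simp
    then have "z \<bullet> z < z \<bullet> k *\<^sub>R m0" using z(2) zz by linarith
    then have zB: "z \<in> B" by (simp add: B_def)
    show "z \<in> \<Omega> \<union> S"
    proof (cases "snd z < 0")
      case True
      then show ?thesis using zB W\<Omega> by (auto simp: W_def)
    next
      case False
      then have z0: "snd z = 0" using z by simp
      have "z \<in> closure \<Omega>"
      proof (clarsimp simp: closure_approachable)
        fix \<epsilon> :: real assume \<epsilon>: "\<epsilon> > 0"
        have "open B" by (simp add: Bball)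
        then obtain \<eta> where \<eta>: "\<eta> > 0" "ball z \<eta> \<subseteq> B" using zB open_contains_ball by blast
        define y where "y = (fst z, - min \<eta> \<epsilon> / 2)"
        have "dist y z = min \<eta> \<epsilon> / 2" using \<eta> \<epsilon> z0 by (cases z) (simp add: y_def dist_Pair_Pair)
        then have "dist y z < \<eta>" "dist y z < \<epsilon>" using \<eta> \<epsilon> by auto
        moreover have "snd y < 0" using \<eta> \<epsilon> by (simp add: y_def)
        ultimately have "y \<in> W" using \<eta> by (auto simp: W_def dist_commute)
        then show "\<exists>y\<in>\<Omega>. dist y z < \<epsilon>" using W\<Omega> \<open>dist y z < \<epsilon>\<close> by blast
      qed
      moreover have "z \<notin> \<Omega>" using \<Omega> z0 by auto
      ultimately have "z \<in> frontier \<Omega>" using \<Omega> by (simp add: frontier_def interior_open)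
      then show ?thesis using zB BPB by (auto simp: parabolic_boundary_def)
    qed
  qed
qed

section \<open>Increments of the operator\<close>

text \<open>One mean value step for each direction: this is the usual argument that continuous partial
  derivatives give a total derivative, with an explicit error and for partial derivatives that are
  known on a set \<open>X\<close> only.\<close>

lemma partial_increments_estimate:
  fixes f :: "'a::real_normed_vector \<Rightarrow> real" and e :: "'i \<Rightarrow> 'a"
  assumes I: "finite I"
   and D: "\<And>i x. i \<in> I \<Longrightarrow> x \<in> X \<Longrightarrow> ((\<lambda>h. f (x + h *\<^sub>R e i)) has_real_derivative g i x) (at 0)"
   and box: "\<And>d. (\<And>i. i \<in> I \<Longrightarrow> \<bar>d i\<bar> \<le> \<bar>c i\<bar>) \<Longrightarrow> a + (\<Sum>i\<in>I. d i *\<^sub>R e i) \<in> X"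
   and close: "\<And>i x. i \<in> I \<Longrightarrow> x \<in> X \<Longrightarrow> \<bar>g i x - \<gamma> i\<bar> \<le> \<omega>"
  shows "\<bar>f (a + (\<Sum>i\<in>I. c i *\<^sub>R e i)) - f a - (\<Sum>i\<in>I. c i * \<gamma> i)\<bar> \<le> \<omega> * (\<Sum>i\<in>I. \<bar>c i\<bar>)"
proof -
  have "J \<subseteq> I \<Longrightarrow> \<bar>f (a + (\<Sum>i\<in>J. c i *\<^sub>R e i)) - f a - (\<Sum>i\<in>J. c i * \<gamma> i)\<bar> \<le> \<omega> * (\<Sum>i\<in>J. \<bar>c i\<bar>)"
    if "finite J" for J
    using that
  proof (induction J)
    case empty
    then show ?case by simp
  next
    case (insert j J)
    let ?b = "a + (\<Sum>i\<in>J. c i *\<^sub>R e i)"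
    have jI: "j \<in> I" using insert by simp
    have inX: "?b + (t * c j) *\<^sub>R e j \<in> X" if t: "0 \<le> t" "t \<le> 1" for t
    proof -
      define d where "d i = (if i = j then t * c j else if i \<in> J then c i else 0)" for i
      have "(\<Sum>i\<in>I. d i *\<^sub>R e i) = (\<Sum>i\<in>insert j J. d i *\<^sub>R e i)"
        using insert I by (intro sum.mono_neutral_right) (auto simp: d_def)
      also have "\<dots> = (t * c j) *\<^sub>R e j + (\<Sum>i\<in>J. d i *\<^sub>R e i)" using insert by (simp add: d_def)
      also have "(\<Sum>i\<in>J. d i *\<^sub>R e i) = (\<Sum>i\<in>J. c i *\<^sub>R e i)"
        using insert by (intro sum.cong) (auto simp: d_def)
      finally have "a + (\<Sum>i\<in>I. d i *\<^sub>R e i) = ?b + (t * c j) *\<^sub>R e j" by (simp add: ac_simps)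
      moreover have "\<bar>d i\<bar> \<le> \<bar>c i\<bar>" for i using t by (auto simp: d_def abs_mult mult_left_le_one_le)
      ultimately show ?thesis using box[of d] by metis
    qed
    have der: "((\<lambda>t. f (?b + (t * c j) *\<^sub>R e j)) has_real_derivative c j * g j (?b + (t * c j) *\<^sub>R e j)) (at t)"
      if t: "0 \<le> t" "t \<le> 1" for t
    proof -
      have 1: "((\<lambda>s. (s - t) * c j) has_real_derivative c j) (at t)"
        by (auto intro!: derivative_eq_intros)
      have 2: "((\<lambda>h. f (?b + (t * c j) *\<^sub>R e j + h *\<^sub>R e j)) has_real_derivative g j (?b + (t * c j) *\<^sub>R e j))
         (at ((t - t) * c j))" using D[OF jI inX[OF t]] by simp
      have eq: "(\<lambda>s. f (?b + (t * c j) *\<^sub>R e j + ((s - t) * c j) *\<^sub>R e j)) = (\<lambda>s. f (?b + (s * c j) *\<^sub>R e j))"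
        by (simp add: algebra_simps)
      from DERIV_chain2[OF 2 1] show ?thesis unfolding eq by (simp only: mult.commute[of "c j"])
    qed
    obtain t where t: "0 < t" "t < 1"
       "f (?b + (1 * c j) *\<^sub>R e j) - f (?b + (0 * c j) *\<^sub>R e j) = (1 - 0) * (c j * g j (?b + (t * c j) *\<^sub>R e j))"
      using MVT2[of 0 1 "\<lambda>t. f (?b + (t * c j) *\<^sub>R e j)" "\<lambda>t. c j * g j (?b + (t * c j) *\<^sub>R e j)"] der by auto
    define x where "x = ?b + (t * c j) *\<^sub>R e j"
    have x: "x \<in> X" "f (?b + c j *\<^sub>R e j) - f ?b = c j * g j x" using inX[of t] t by (auto simp: x_def)
    have "\<bar>c j * g j x - c j * \<gamma> j\<bar> = \<bar>c j\<bar> * \<bar>g j x - \<gamma> j\<bar>"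
      by (simp add: abs_mult[symmetric] right_diff_distrib)
    also have "\<dots> \<le> \<bar>c j\<bar> * \<omega>" using close[OF jI x(1)] by (intro mult_left_mono) auto
    finally have A: "\<bar>f (?b + c j *\<^sub>R e j) - f ?b - c j * \<gamma> j\<bar> \<le> \<omega> * \<bar>c j\<bar>" using x by (simp add: mult.commute)
    have B: "\<bar>f ?b - f a - (\<Sum>i\<in>J. c i * \<gamma> i)\<bar> \<le> \<omega> * (\<Sum>i\<in>J. \<bar>c i\<bar>)" using insert by simp
    have C: "a + (\<Sum>i\<in>insert j J. c i *\<^sub>R e i) = ?b + c j *\<^sub>R e j" using insert by (simp add: ac_simps)
    have "\<bar>f (?b + c j *\<^sub>R e j) - f a - (c j * \<gamma> j + (\<Sum>i\<in>J. c i * \<gamma> i))\<bar>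
        \<le> \<omega> * \<bar>c j\<bar> + \<omega> * (\<Sum>i\<in>J. \<bar>c i\<bar>)"
      using A B by linarith
    then show ?case unfolding C using insert by (simp add: distrib_left)
  qed
  from this[OF I order.refl] show ?thesis .
qed

lemma sum_UNIV_sum_type:
  "(\<Sum>x\<in>(UNIV :: ('a::finite + 'b::finite) set). f x) = (\<Sum>a\<in>UNIV. f (Inl a)) + (\<Sum>b\<in>UNIV. f (Inr b))"
  unfolding UNIV_Plus_UNIV[symmetric] by (subst sum.Plus) auto

lemma sum_UNIV_prod_type:
  "(\<Sum>x\<in>(UNIV :: ('a::finite \<times> 'b::finite) set). f x) = (\<Sum>a\<in>UNIV. \<Sum>b\<in>UNIV. f (a, b))"
  unfolding UNIV_Times_UNIV[symmetric] by (simp add: sum.cartesian_product)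

lemma sym_matrices_iff: "M \<in> sym_matrices \<longleftrightarrow> (\<forall>i j. M $ i $ j = M $ j $ i)"
  unfolding sym_matrices_def mem_Collect_eq transpose_def vec_eq_iff vec_lambda_beta by blast

text \<open>The entries weigh the symmetrised units correctly: off the diagonal each pair occurs twice with weight
  one half.\<close>

lemma sym_matrix_expansion:
  fixes M :: "real ^ 'n ^ 'n"
  assumes "M \<in> sym_matrices"
  shows "(\<Sum>i\<in>UNIV. \<Sum>j\<in>UNIV. (M $ i $ j) *\<^sub>R sym_unit i j) = M"
proof (intro vec_eq_iff[THEN iffD2] allI)
  fix a b
  have sym: "M $ b $ a = M $ a $ b" using assms unfolding sym_matrices_iff by blast
  have "(\<Sum>i\<in>UNIV. \<Sum>j\<in>UNIV. (M $ i $ j) *\<^sub>R sym_unit i j) $ a $ b =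
     (\<Sum>i\<in>UNIV. \<Sum>j\<in>UNIV. (if j = b then if i = a then M $ i $ j / 2 else 0 else 0)) +
     (\<Sum>i\<in>UNIV. \<Sum>j\<in>UNIV. (if j = a then if i = b then M $ i $ j / 2 else 0 else 0))"
    unfolding sum_component sum.distrib[symmetric]
    by (intro sum.cong refl) (auto simp: sym_unit_def)
  also have "\<dots> = M $ a $ b"
    by (simp add: sym)
  finally show "(\<Sum>i\<in>UNIV. \<Sum>j\<in>UNIV. (M $ i $ j) *\<^sub>R sym_unit i j) $ a $ b = M $ a $ b" .
qed

lemma sym_matrices_add: "M \<in> sym_matrices \<Longrightarrow> N \<in> sym_matrices \<Longrightarrow> M + N \<in> sym_matrices"
  unfolding sym_matrices_iff vector_add_component by metis

lemma sym_matrices_scaleR: "M \<in> sym_matrices \<Longrightarrow> c *\<^sub>R M \<in> sym_matrices"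
  unfolding sym_matrices_iff vector_scaleR_component by metis

lemma sym_matrices_zero: "0 \<in> sym_matrices"
  by (simp add: sym_matrices_iff)

lemma sym_unit_symmetric: "sym_unit i j \<in> sym_matrices"
  unfolding sym_matrices_iff sym_unit_def vec_lambda_beta by (simp add: conj_commute add.commute)

lemmas sym_matrices_closed = sym_matrices_add sym_matrices_scaleR sym_matrices_zero sym_unit_symmetric

lemma sum_sym_matrices: "(\<And>x. x \<in> A \<Longrightarrow> f x \<in> sym_matrices) \<Longrightarrow> sum f A \<in> sym_matrices"
  by (induction A rule: infinite_finite_induct) (auto simp: sym_matrices_closed)

lemma continuous_on_near_point:
  fixes h :: "'a::metric_space \<Rightarrow> 'b::metric_space"
  assumes "continuous_on Y h" "y0 \<in> Y" "\<omega> > 0"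
  obtains r where "r > 0" "\<And>y. y \<in> Y \<Longrightarrow> dist y y0 < r \<Longrightarrow> dist (h y) (h y0) < \<omega>"
  using assms unfolding continuous_on_iff by blast

text \<open>The increments of \<open>F\<close> in all variables but \<open>z\<close>, compared with the linearisation frozen at
  \<open>(z0, s0, p0, M0)\<close>. The directions are the coordinate directions of \<open>s\<close> and \<open>p\<close> and the
  symmetrised matrix units, so that intermediate points keep a symmetric last component.\<close>

lemma operator_increment_lower_bound:
  fixes F :: "'n::finite nlop"
  assumes C1: "C1_in_spM K F" and z0: "z0 \<in> K" and M0: "M0 \<in> sym_matrices" and \<omega>: "\<omega> > 0"
  obtains r where "r > 0"
   "\<And>z s p M s' p' M'. z \<in> K \<Longrightarrow> dist z z0 < r \<Longrightarrow> M \<in> sym_matrices \<Longrightarrow> M' \<in> sym_matrices \<Longrightarrow>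
     dist (s, p, M) (s0, p0, M0) < r \<Longrightarrow> norm (s', p', M') < r \<Longrightarrow>
     F z (s + s') (p + p') (M + M') - F z s p M
      \<ge> s' * deriv_s F z0 s0 p0 M0 + (\<Sum>i\<in>UNIV. p' $ i * deriv_p F z0 s0 p0 M0 $ i)
        + (\<Sum>i\<in>UNIV. \<Sum>j\<in>UNIV. M' $ i $ j * deriv_M F z0 s0 p0 M0 $ i $ j)
        - \<omega> * (\<bar>s'\<bar> + (\<Sum>i\<in>UNIV. \<bar>p' $ i\<bar>) + (\<Sum>i\<in>UNIV. \<Sum>j\<in>UNIV. \<bar>M' $ i $ j\<bar>))"
proof -
  let ?Y = "K \<times> UNIV \<times> UNIV \<times> sym_matrices :: ('n spt \<times> real \<times> (real ^ 'n) \<times> (real ^ 'n ^ 'n)) set"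
  let ?y0 = "(z0, s0, p0, M0)"
  have y0: "?y0 \<in> ?Y" using z0 M0 by simp
  have cont: "continuous_on ?Y (\<lambda>(z, s, p, M). deriv_s F z s p M)"
     "continuous_on ?Y (\<lambda>(z, s, p, M). deriv_p F z s p M)"
     "continuous_on ?Y (\<lambda>(z, s, p, M). deriv_M F z s p M)"
    using C1 by (auto simp: C1_in_spM_def)
  obtain r1 where r1: "r1 > 0" "\<And>y. y \<in> ?Y \<Longrightarrow> dist y ?y0 < r1 \<Longrightarrow>
       dist ((\<lambda>(z, s, p, M). deriv_s F z s p M) y) (deriv_s F z0 s0 p0 M0) < \<omega>"
    using continuous_on_near_point[OF cont(1) y0 \<omega>] by auto
  obtain r2 where r2: "r2 > 0" "\<And>y. y \<in> ?Y \<Longrightarrow> dist y ?y0 < r2 \<Longrightarrow>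
       dist ((\<lambda>(z, s, p, M). deriv_p F z s p M) y) (deriv_p F z0 s0 p0 M0) < \<omega>"
    using continuous_on_near_point[OF cont(2) y0 \<omega>] by auto
  obtain r3 where r3: "r3 > 0" "\<And>y. y \<in> ?Y \<Longrightarrow> dist y ?y0 < r3 \<Longrightarrow>
       dist ((\<lambda>(z, s, p, M). deriv_M F z s p M) y) (deriv_M F z0 s0 p0 M0) < \<omega>"
    using continuous_on_near_point[OF cont(3) y0 \<omega>] by auto
  define R where "R = min r1 (min r2 r3)"
  have R: "R > 0" using r1 r2 r3 by (simp add: R_def)
  define e :: "unit + 'n + 'n \<times> 'n \<Rightarrow> real \<times> (real ^ 'n) \<times> (real ^ 'n ^ 'n)" where
    "e i = (case i of Inl u \<Rightarrow> (1, 0, 0) | Inr (Inl i) \<Rightarrow> (0, axis i 1, 0) | Inr (Inr (i, j)) \<Rightarrow> (0, 0, sym_unit i j))" for i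
  define L where "L = (\<Sum>i\<in>UNIV. norm (e i))"
  have L: "L \<ge> 0" by (simp add: L_def sum_nonneg)
  define r where "r = R / (L + 2)"
  have r: "r > 0" "r * (L + 2) = R" using R L by (simp_all add: r_def)
  define g :: "'n spt \<Rightarrow> unit + 'n + 'n \<times> 'n \<Rightarrow> real \<times> (real ^ 'n) \<times> (real ^ 'n ^ 'n) \<Rightarrow> real" where
    "g z i x = (case x of (s, p, M) \<Rightarrow> (case i of Inl u \<Rightarrow> deriv_s F z s p M
        | Inr (Inl i) \<Rightarrow> deriv_p F z s p M $ i | Inr (Inr (i, j)) \<Rightarrow> deriv_M F z s p M $ i $ j))" for z i x
  show thesis
  proof (rule that[OF r(1)])
    fix z :: "'n spt" and s s' :: real and p p' :: "real ^ 'n" and M M' :: "real ^ 'n ^ 'n"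
    assume z: "z \<in> K" "dist z z0 < r" and M: "M \<in> sym_matrices" "M' \<in> sym_matrices"
      and near: "dist (s, p, M) (s0, p0, M0) < r" and inc: "norm (s', p', M') < r"
    define X where "X = {(s, p, M :: real ^ 'n ^ 'n). M \<in> sym_matrices \<and> dist (z, s, p, M) ?y0 < R}"
    define f where "f = (\<lambda>(s, p, M). F z s p M)"
    define c where "c i = (case i of Inl (u :: unit) \<Rightarrow> s' | Inr (Inl i) \<Rightarrow> p' $ i | Inr (Inr (i, j)) \<Rightarrow> M' $ i $ j)" for i
    have cr: "\<bar>c i\<bar> \<le> r" for i
    proof -
      have 1: "\<bar>s'\<bar> \<le> r" using norm_fst_le[of s' "(p', M')"] inc by simp
      have n: "norm p' \<le> r" "norm M' \<le> r"
        using norm_snd_le[of "(p', M')" s'] norm_fst_le[of p' M'] norm_snd_le[of M' p'] inc by linarith+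
      have 2: "\<bar>p' $ i\<bar> \<le> r" for i
        using component_le_norm_cart[of p' i] n by linarith
      have 3: "\<bar>M' $ i $ j\<bar> \<le> r" for i j
        using component_le_norm_cart[of "M' $ i" j] Finite_Cartesian_Product.norm_nth_le[of M' i] n by linarith
      show ?thesis using 1 2 3 by (auto simp: c_def split: sum.split)
    qed
    have total: "(\<Sum>i\<in>UNIV. c i *\<^sub>R e i) = (s', p', M')"
    proof -
      have "(\<Sum>i\<in>UNIV. p' $ i *\<^sub>R axis i (1::real)) = p'"
        by (simp add: vec_eq_iff axis_def if_distrib cong: if_cong)
      moreover have "(\<Sum>i\<in>UNIV. (0::real, p' $ i *\<^sub>R axis i (1::real), 0 :: real^'n^'n)) = (0, \<Sum>i\<in>UNIV. p' $ i *\<^sub>R axis i (1::real), 0)"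
        by (simp add: prod_eq_iff fst_sum snd_sum)
      moreover have "(\<Sum>i\<in>UNIV. \<Sum>j\<in>UNIV. (0::real, 0 :: real^'n, M' $ i $ j *\<^sub>R sym_unit i j))
           = (0, 0, \<Sum>i\<in>UNIV. \<Sum>j\<in>UNIV. M' $ i $ j *\<^sub>R sym_unit i j)"
        by (simp add: prod_eq_iff fst_sum snd_sum)
      ultimately show ?thesis
        by (simp add: sum_UNIV_sum_type sum_UNIV_prod_type UNIV_unit c_def e_def sym_matrix_expansion[OF M(2)])
    qed
    have dsym: "snd (snd (e i)) \<in> sym_matrices" for i
      by (auto simp: e_def sym_matrices_closed split: sum.split)
    have "\<bar>f ((s, p, M) + (\<Sum>i\<in>UNIV. c i *\<^sub>R e i)) - f (s, p, M) - (\<Sum>i\<in>UNIV. c i * g z0 i (s0, p0, M0))\<bar>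
        \<le> \<omega> * (\<Sum>i\<in>UNIV. \<bar>c i\<bar>)"
    proof (rule partial_increments_estimate[where X = X and g = "g z"])
      fix i x assume "x \<in> X"
      then obtain s p M where x: "x = (s, p, M)" "M \<in> sym_matrices" "dist (z, s, p, M) ?y0 < R"
        by (auto simp: X_def)
      show "((\<lambda>h. f (x + h *\<^sub>R e i)) has_real_derivative g z i x) (at 0)"
      proof (cases i)
        case (Inl u)
        have "(\<lambda>r. F z r p M) field_differentiable at s" using C1 z x by (simp add: C1_in_spM_def)
        then have "((\<lambda>r. F z r p M) has_real_derivative deriv_s F z s p M) (at (s + 0))"
          unfolding deriv_s_def by (simp add: field_differentiable_derivI)
        then show ?thesis using Inl DERIV_shift[of "\<lambda>r. F z r p M" "deriv_s F z s p M" 0 s]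
          by (simp add: f_def e_def g_def x add.commute)
      next
        case (Inr k)
        show ?thesis
        proof (cases k)
          case (Inl a)
          have "(\<lambda>h. F z s (p + h *\<^sub>R axis a 1) M) field_differentiable at 0" using C1 z x by (simp add: C1_in_spM_def)
          from field_differentiable_derivI[OF this] show ?thesis
            using Inl Inr by (simp add: f_def e_def g_def x deriv_p_def)
        next
          case (Inr ab)
          obtain a b where ab: "ab = (a, b)" by (cases ab)
          have "(\<lambda>h. F z s p (M + h *\<^sub>R sym_unit a b)) field_differentiable at 0" using C1 z x by (simp add: C1_in_spM_def)
          from field_differentiable_derivI[OF this] show ?thesis
            using Inr \<open>i = Inr k\<close> by (simp add: f_def e_def g_def x deriv_M_def ab)
        qed
      qed
      have y: "(z, s, p, M) \<in> ?Y" using z x by simp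
      have "\<bar>deriv_s F z s p M - deriv_s F z0 s0 p0 M0\<bar> < \<omega>"
        using r1(2)[OF y] x by (simp add: R_def dist_real_def)
      moreover have "\<bar>deriv_p F z s p M $ i - deriv_p F z0 s0 p0 M0 $ i\<bar> < \<omega>" for i
        using r2(2)[OF y] x component_le_norm_cart[of "deriv_p F z s p M - deriv_p F z0 s0 p0 M0" i]
        by (simp add: R_def dist_norm)
      moreover have "\<bar>deriv_M F z s p M $ i $ j - deriv_M F z0 s0 p0 M0 $ i $ j\<bar> < \<omega>" for i j
        using r3(2)[OF y] x component_le_norm_cart[of "(deriv_M F z s p M - deriv_M F z0 s0 p0 M0) $ i" j]
          Finite_Cartesian_Product.norm_nth_le[of "deriv_M F z s p M - deriv_M F z0 s0 p0 M0" i]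
        by (simp add: R_def dist_norm)
      ultimately show "\<bar>g z i x - g z0 i (s0, p0, M0)\<bar> \<le> \<omega>"
        by (auto simp: g_def x less_imp_le split: sum.split)
    next
      fix d assume d: "\<And>i. i \<in> UNIV \<Longrightarrow> \<bar>d i\<bar> \<le> \<bar>c i\<bar>"
      define D where "D = (\<Sum>i\<in>UNIV. d i *\<^sub>R e i)"
      have "norm D \<le> (\<Sum>i\<in>UNIV. r * norm (e i))" unfolding D_def
      proof (rule sum_norm_le)
        fix i show "norm (d i *\<^sub>R e i) \<le> r * norm (e i)"
          using d[of i] cr[of i] by (auto intro!: mult_right_mono)
      qed
      also have "\<dots> = r * L" by (simp add: L_def sum_distrib_left)
      finally have nD: "norm D \<le> r * L" .
      have symD: "snd (snd D) \<in> sym_matrices"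
        unfolding D_def snd_sum by (intro sum_sym_matrices) (simp add: sym_matrices_closed dsym)
      obtain s1 p1 M1 where sD: "(s, p, M) + D = (s1, p1, M1)" by (cases "(s, p, M) + D")
      have "dist (z, (s, p, M) + D) ?y0 \<le> dist z z0 + dist ((s, p, M) + D) (s0, p0, M0)"
        unfolding dist_norm using norm_Pair_le[of "z - z0" "(s, p, M) + D - (s0, p0, M0)"] by simp
      also have "dist ((s, p, M) + D) (s0, p0, M0) \<le> norm D + dist (s, p, M) (s0, p0, M0)"
        using dist_triangle[of "(s, p, M) + D" "(s0, p0, M0)" "(s, p, M)"]
        by (simp only: dist_norm add_diff_cancel_left')
      finally have "dist (z, (s, p, M) + D) ?y0 < r * (L + 2)" using z near nD by (simp add: algebra_simps)
      then have "dist (z, s1, p1, M1) ?y0 < R" using r sD by simp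
      moreover have "M1 \<in> sym_matrices" using sD symD M sym_matrices_closed(1)
        by (metis snd_add snd_conv)
      ultimately show "(s, p, M) + (\<Sum>i\<in>UNIV. d i *\<^sub>R e i) \<in> X"
        using sD by (simp add: D_def X_def)
    qed simp
    then show "F z (s + s') (p + p') (M + M') - F z s p M
      \<ge> s' * deriv_s F z0 s0 p0 M0 + (\<Sum>i\<in>UNIV. p' $ i * deriv_p F z0 s0 p0 M0 $ i)
        + (\<Sum>i\<in>UNIV. \<Sum>j\<in>UNIV. M' $ i $ j * deriv_M F z0 s0 p0 M0 $ i $ j)
        - \<omega> * (\<bar>s'\<bar> + (\<Sum>i\<in>UNIV. \<bar>p' $ i\<bar>) + (\<Sum>i\<in>UNIV. \<Sum>j\<in>UNIV. \<bar>M' $ i $ j\<bar>))"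
      unfolding total
      by (simp add: f_def c_def g_def sum_UNIV_sum_type sum_UNIV_prod_type UNIV_unit abs_le_iff algebra_simps)
  qed
qed

section \<open>Touching from below\<close>

lemma clext_inside: "x \<in> D \<Longrightarrow> clext D g x = g x"
  by (simp add: clext_def)

text \<open>At points with \<open>snd z1 = 0\<close> the segment from \<open>z1\<close> to \<open>z1 + y\<close> may run in the boundary, where \<open>v\<close> has
  no derivatives of its own. Shift the segment downwards into \<open>\<Omega>\<close> by \<open>\<tau>\<close>, apply Taylor's formula
  there, and let \<open>\<tau> \<rightarrow> 0\<close>.\<close>

lemma taylor_lower_bound_from_below:
  fixes v :: "'a::euclidean_space \<times> real \<Rightarrow> real"
  assumes \<Omega>: "open \<Omega>" and v: "C2_on_closure \<Omega> v"
    and r: "r > 0" "\<And>z. dist z z1 < r \<Longrightarrow> snd z < 0 \<Longrightarrow> z \<in> \<Omega>" and z1: "snd z1 \<le> 0" and \<omega>: "\<omega> > 0"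
  obtains \<rho> where "\<rho> > 0"
    "\<And>y. norm y < \<rho> \<Longrightarrow> snd (z1 + y) \<le> 0 \<Longrightarrow>
      v (z1 + y) \<ge> v z1 + (\<Sum>b\<in>Basis. (y \<bullet> b) * clext \<Omega> (pd b v) z1)
        + (\<Sum>b\<in>Basis. \<Sum>b'\<in>Basis. (y \<bullet> b) * (y \<bullet> b') * clext \<Omega> (pd b (pd b' v)) z1) / 2
        - \<omega> * (norm y)\<^sup>2"
proof -
  let ?d = "real (DIM('a \<times> real) * DIM('a \<times> real))"
  have d: "?d > 0" by (simp only: of_nat_0_less_iff nat_0_less_mult_iff DIM_positive)
  \<comment> \<open>The remainder collects one error term for each pair of basis vectors.\<close>
  define \<omega>' where "\<omega>' = \<omega> / ?d"
  have \<omega>': "\<omega>' > 0" "?d * \<omega>' = \<omega>" using \<omega> d by (simp_all add: \<omega>'_def)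
  have C2: "C2_on \<Omega> v" and cv: "continuous_on (closure \<Omega>) v"
    and cD: "\<And>e. continuous_on (closure \<Omega>) (clext \<Omega> (pd e v))"
    and cH: "\<And>d e. continuous_on (closure \<Omega>) (clext \<Omega> (pd d (pd e v)))"
    using v by (auto simp: C2_on_closure_def)
  define dn where "dn \<tau> = (0 :: 'a, - \<tau> :: real)" for \<tau>
  have dn_lim: "((\<lambda>\<tau>. x + dn \<tau>) \<longlongrightarrow> x) (at_right 0)" for x
  proof -
    have "((\<lambda>\<tau>. x + (0, - \<tau>)) \<longlongrightarrow> x + (0, - 0)) (at_right (0::real))"
      by (intro tendsto_intros)
    then show ?thesis by (simp add: dn_def zero_prod_def[symmetric])
  qed
  have in\<Omega>: "\<forall>\<^sub>F \<tau> in at_right 0. x + dn \<tau> \<in> \<Omega>" if x: "dist x z1 < r" "snd x \<le> 0" for x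
  proof -
    have "\<forall>\<^sub>F \<tau> in at_right 0. x + dn \<tau> \<in> ball z1 r"
      by (rule topological_tendstoD[OF dn_lim]) (use x in \<open>auto simp: dist_commute\<close>)
    moreover have "\<forall>\<^sub>F \<tau> in at_right 0. (\<tau>::real) > 0" by (simp add: eventually_at_right_less)
    ultimately show ?thesis
      by eventually_elim (rule r(2); use x in \<open>auto simp: dn_def dist_commute\<close>)
  qed
  have incl: "x \<in> closure \<Omega>" if x: "dist x z1 < r" "snd x \<le> 0" for x
    by (rule Lim_in_closed_set[OF closed_closure _ _ dn_lim[of x]])
       (use eventually_mono[OF in\<Omega>[OF x], of "\<lambda>\<tau>. x + dn \<tau> \<in> closure \<Omega>"] closure_subset in auto)
  have lim: "((\<lambda>\<tau>. g (x + dn \<tau>)) \<longlongrightarrow> g x) (at_right 0)"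
    if "continuous_on (closure \<Omega>) g" "dist x z1 < r" "snd x \<le> 0" for g :: "_ \<Rightarrow> real" and x
    by (rule continuous_on_tendsto_compose[OF that(1) dn_lim incl[OF that(2,3)]])
       (use eventually_mono[OF in\<Omega>[OF that(2,3)], of "\<lambda>\<tau>. x + dn \<tau> \<in> closure \<Omega>"] closure_subset in auto)
  have z1c: "dist z1 z1 < r" using r by simp
  have near: "\<exists>\<delta>>0. \<forall>x\<in>closure \<Omega>. dist x z1 < \<delta> \<longrightarrow>
      dist (clext \<Omega> (pd b (pd b' v)) x) (clext \<Omega> (pd b (pd b' v)) z1) < \<omega>'" for b b'
    using cH[of b b'] incl[OF z1c z1] \<omega>' unfolding continuous_on_iff by blast
  obtain \<delta> where \<delta>: "\<And>b b'. \<delta> b b' > 0" "\<And>b b' x. x \<in> closure \<Omega> \<Longrightarrow> dist x z1 < \<delta> b b' \<Longrightarrow>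
      dist (clext \<Omega> (pd b (pd b' v)) x) (clext \<Omega> (pd b (pd b' v)) z1) < \<omega>'"
    using near by metis
  define R where "R = Min (insert r ((\<lambda>(b, b'). \<delta> b b') ` (Basis \<times> Basis)))"
  have R: "R > 0" "R \<le> r" unfolding R_def using r \<delta> by auto
  have R': "R \<le> \<delta> b b'" if "b \<in> Basis" "b' \<in> Basis" for b b'
    unfolding R_def using that by (auto simp del: Min_insert intro!: Min_le)
  show thesis
  proof (rule that[of "R / 2"])
    show "R / 2 > 0" using R by simp
    fix y assume y: "norm y < R / 2" "snd (z1 + y) \<le> 0"
    have close_y: "dist (z1 + y) z1 < r"
      using y(1) R norm_ge_zero[of y] unfolding dist_norm add_diff_cancel_left' by linarith
    have "\<forall>\<^sub>F \<tau> in at_right 0. (\<tau>::real) > 0 \<and> \<tau> < R / 2"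
      by (rule eventually_mono[OF eventually_at_right_real[of 0 "R / 2"]]) (use R in auto)
    then have ev: "\<forall>\<^sub>F \<tau> in at_right 0.
       v (z1 + dn \<tau>) + (\<Sum>b\<in>Basis. (y \<bullet> b) * clext \<Omega> (pd b v) (z1 + dn \<tau>))
        + (\<Sum>b\<in>Basis. \<Sum>b'\<in>Basis. (y \<bullet> b) * (y \<bullet> b') * clext \<Omega> (pd b (pd b' v)) z1) / 2
        - ?d * \<omega>' * (norm y)\<^sup>2 / 2 \<le> v (z1 + y + dn \<tau>)"
    proof eventually_elim
      fix \<tau> :: real assume \<tau>: "\<tau> > 0 \<and> \<tau> < R / 2"
      have seg: "z1 + dn \<tau> + t *\<^sub>R y \<in> \<Omega> \<and> dist (z1 + dn \<tau> + t *\<^sub>R y) z1 < R" if t: "0 \<le> t" "t \<le> 1" for t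
      proof -
        have "dist (z1 + dn \<tau> + t *\<^sub>R y) z1 = norm (dn \<tau> + t *\<^sub>R y)" by (simp add: dist_norm add.assoc)
        also have "\<dots> \<le> norm (dn \<tau>) + norm (t *\<^sub>R y)" by (rule norm_triangle_ineq)
        also have "norm (dn \<tau>) = \<tau>" using \<tau> by (simp add: dn_def norm_Pair)
        also have "norm (t *\<^sub>R y) \<le> norm y" using t by (simp add: mult_left_le_one_le)
        finally have *: "dist (z1 + dn \<tau> + t *\<^sub>R y) z1 < R" using \<tau> y by simp
        have "snd (z1 + dn \<tau> + t *\<^sub>R y) = (1 - t) * snd z1 + t * snd (z1 + y) - \<tau>"
          by (simp add: dn_def algebra_simps)
        also have "\<dots> < 0"
        proof -
          have "(1 - t) * snd z1 \<le> 0" "t * snd (z1 + y) \<le> 0" using t z1 y by (auto intro: mult_nonneg_nonpos)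
          then show ?thesis using \<tau> by linarith
        qed
        finally show ?thesis using * r(2) R by auto
      qed
      have "v (z1 + dn \<tau> + y) \<ge> v (z1 + dn \<tau>) + (\<Sum>b\<in>Basis. (y \<bullet> b) * pd b v (z1 + dn \<tau>))
        + (\<Sum>b\<in>Basis. \<Sum>b'\<in>Basis. (y \<bullet> b) * (y \<bullet> b') * clext \<Omega> (pd b (pd b' v)) z1) / 2
        - ?d * \<omega>' * (norm y)\<^sup>2 / 2"
      proof (rule second_order_taylor_lower_bound[OF \<Omega> C2])
        fix t :: real assume t: "0 \<le> t" "t \<le> 1"
        show "z1 + dn \<tau> + t *\<^sub>R y \<in> \<Omega>" using seg[OF t] by simp
        fix b b' :: "'a \<times> real" assume b: "b \<in> Basis" "b' \<in> Basis"
        have "z1 + dn \<tau> + t *\<^sub>R y \<in> closure \<Omega>" using seg[OF t] closure_subset by blast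
        from \<delta>(2)[OF this, of b b'] seg[OF t] R'[OF b]
        show "\<bar>pd b (pd b' v) (z1 + dn \<tau> + t *\<^sub>R y) - clext \<Omega> (pd b (pd b' v)) z1\<bar> \<le> \<omega>'"
          by (simp add: clext_inside dist_real_def)
      qed
      moreover have "z1 + dn \<tau> \<in> \<Omega>" using seg[of 0] by simp
      ultimately show "v (z1 + dn \<tau>) + (\<Sum>b\<in>Basis. (y \<bullet> b) * clext \<Omega> (pd b v) (z1 + dn \<tau>))
        + (\<Sum>b\<in>Basis. \<Sum>b'\<in>Basis. (y \<bullet> b) * (y \<bullet> b') * clext \<Omega> (pd b (pd b' v)) z1) / 2
        - ?d * \<omega>' * (norm y)\<^sup>2 / 2 \<le> v (z1 + y + dn \<tau>)"
        by (simp add: clext_inside add.assoc add.commute[of "dn \<tau>" y])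
    qed
    have "v z1 + (\<Sum>b\<in>Basis. (y \<bullet> b) * clext \<Omega> (pd b v) z1)
        + (\<Sum>b\<in>Basis. \<Sum>b'\<in>Basis. (y \<bullet> b) * (y \<bullet> b') * clext \<Omega> (pd b (pd b' v)) z1) / 2
        - ?d * \<omega>' * (norm y)\<^sup>2 / 2 \<le> v (z1 + y)"
      by (rule tendsto_le[OF _ lim[OF cv close_y y(2)] _ ev])
         (auto intro!: tendsto_intros lim[OF cv z1c z1] lim[OF cD z1c z1])
    moreover have "?d * \<omega>' * (norm y)\<^sup>2 / 2 \<le> \<omega> * (norm y)\<^sup>2" unfolding \<omega>'(2) using \<omega> by simp
    ultimately show "v (z1 + y) \<ge> v z1 + (\<Sum>b\<in>Basis. (y \<bullet> b) * clext \<Omega> (pd b v) z1)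
        + (\<Sum>b\<in>Basis. \<Sum>b'\<in>Basis. (y \<bullet> b) * (y \<bullet> b') * clext \<Omega> (pd b (pd b' v)) z1) / 2
        - \<omega> * (norm y)\<^sup>2" by linarith
  qed
qed

lemma clext_pd_commute:
  assumes \<Omega>: "open \<Omega>" and v: "C2_on_closure \<Omega> v" and z: "z \<in> closure \<Omega>"
  shows "clext \<Omega> (pd d (pd e v)) z = clext \<Omega> (pd e (pd d v)) z"
proof -
  have C2: "C2_on \<Omega> v" and c: "\<And>d e. continuous_on (closure \<Omega>) (clext \<Omega> (pd d (pd e v)))"
    using v by (auto simp: C2_on_closure_def)
  have "clext \<Omega> (pd d (pd e v)) z - clext \<Omega> (pd e (pd d v)) z = 0"
    by (rule continuous_constant_on_closure[OF continuous_on_diff[OF c c] _ z])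
       (simp add: clext_inside pd_commute[OF \<Omega> _ C2])
  then show ?thesis by simp
qed

text \<open>Without a minimum, the relatively open sets \<open>{z. f y < f z}\<close> for \<open>y \<in> G\<close> would cover \<open>G\<close>, and a best \<open>y\<close>
  among those of a finite subcover would be left uncovered.\<close>

lemma lsc_minus_continuous_attains_min:
  assumes G: "compact G" "G \<noteq> {}" "G \<subseteq> X" and u: "lsc_on X u" and w: "continuous_on G w"
  obtains z where "z \<in> G" "\<And>y. y \<in> G \<Longrightarrow> u z - w z \<le> u y - (w y :: real)"
proof -
  have op: "openin (top_of_set G) {z \<in> G. a < u z - w z}" for a
  proof -
    have "{z \<in> G. a < u z - w z} = (\<Union>c. {z \<in> G. c < u z} \<inter> {z \<in> G. w z < c - a})"
    proof (intro equalityI subsetI)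
      fix z assume z: "z \<in> {z \<in> G. a < u z - w z}"
      then have "w z + a < u z" by simp
      then obtain c where "w z + a < c" "c < u z" using dense by blast
      then show "z \<in> (\<Union>c. {z \<in> G. c < u z} \<inter> {z \<in> G. w z < c - a})" using z by (intro UN_I[of c]) auto
    qed auto
    moreover have "openin (top_of_set G) {z \<in> G. c < u z}" for c
    proof -
      have "openin (top_of_set X) {z \<in> X. c < u z}" using u by (simp add: lsc_on_def)
      from openin_subtopology_Int[OF this, of G] G(3)
      have "openin (top_of_set (X \<inter> G)) ({z \<in> X. c < u z} \<inter> G)" by (simp add: subtopology_subtopology)
      moreover have "{z \<in> X. c < u z} \<inter> G = {z \<in> G. c < u z}" "X \<inter> G = G" using G(3) by auto
      ultimately show ?thesis by simp
    qed
    moreover have "openin (top_of_set G) {z \<in> G. w z < c - a}" for c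
    proof -
      have "{z \<in> G. w z < c - a} = G \<inter> w -` {..<c - a}" by auto
      then show ?thesis using continuous_openin_preimage_gen[OF w, of "{..<c - a}"] by simp
    qed
    ultimately show ?thesis by (simp only:) (intro openin_Union openin_Int; blast)
  qed
  have "\<exists>z\<in>G. \<forall>y\<in>G. u z - w z \<le> u y - w y"
  proof (rule ccontr)
    assume "\<not> ?thesis"
    then have nomin: "\<exists>y\<in>G. u y - w y < u z - w z" if "z \<in> G" for z
      using that by (meson not_le_imp_less)
    let ?C = "(\<lambda>y. {z \<in> G. u y - w y < u z - w z}) ` G"
    have "\<forall>c\<in>?C. openin (top_of_set G) c" "G \<subseteq> \<Union>?C" using op nomin by auto
    then obtain D where D: "D \<subseteq> ?C" "finite D" "G \<subseteq> \<Union>D"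
      using G(1) unfolding compact_eq_openin_cover by meson
    obtain Y where Y: "Y \<subseteq> G" "finite Y" "D = (\<lambda>y. {z \<in> G. u y - w y < u z - w z}) ` Y"
      using finite_subset_image[OF D(2,1)] by blast
    have "Y \<noteq> {}" using Y D G by auto
    then have "Min ((\<lambda>y. u y - w y) ` Y) \<in> (\<lambda>y. u y - w y) ` Y" using Y(2) by (intro Min_in) auto
    then obtain y0 where "y0 \<in> Y" "Min ((\<lambda>y. u y - w y) ` Y) = u y0 - w y0" by blast
    moreover have "Min ((\<lambda>y. u y - w y) ` Y) \<le> u y - w y" if "y \<in> Y" for y
      using Y(2) that by (intro Min_le) auto
    ultimately have y0: "y0 \<in> Y" "\<And>y. y \<in> Y \<Longrightarrow> u y0 - w y0 \<le> u y - w y" by simp_all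
    then have "y0 \<in> \<Union>D" using D(3) Y(1) by blast
    then obtain y where "y \<in> Y" "u y - w y < u y0 - w y0" using Y by auto
    then show False using y0 by fastforce
  qed
  then show thesis using that by blast
qed

lemma viscosity_at_quadratic_touching:
  fixes F :: "'n::finite nlop" and B :: "'n spt \<Rightarrow> 'n spt"
  assumes visc: "viscosity_le F \<Omega> S u v" and z1: "z1 \<in> \<Omega> \<union> S" and B: "linear B" and r: "r > 0"
    and below: "\<And>z. z \<in> \<Omega> \<union> S \<Longrightarrow> dist z z1 < r \<Longrightarrow> u z1 + l \<bullet> (z - z1) + ((z - z1) \<bullet> B (z - z1)) / 2 \<le> u z"
  shows "F z1 (u z1) (fst l) (\<chi> i j. ((axis i 1, 0) \<bullet> B (axis j 1, 0) + (axis j 1, 0) \<bullet> B (axis i 1, 0)) / 2) - snd l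
     \<le> parabolic_op F \<Omega> v z1"
proof -
  let ?\<phi> = "\<lambda>z. u z1 + l \<bullet> (z - z1) + ((z - z1) \<bullet> B (z - z1)) / 2"
  let ?U = "ball z1 r"
  note Q = quadratic_derivatives[OF B, where c="u z1" and l=l and ?z1.0=z1]
  have "parabolic_op F ?U ?\<phi> z1 \<le> parabolic_op F \<Omega> v z1"
    using visc z1 r below C2_on_subset[OF Q(1), of ?U]
    unfolding viscosity_le_def by (elim ballE[of _ _ z1] allE[of _ ?U] allE[of _ ?\<phi>] impE) (auto simp: dist_commute linear_0[OF B])
  moreover have "z1 \<in> ?U" using r by simp
  moreover have "l \<bullet> (axis i 1, 0) = fst l $ i" for i by (cases l) (simp add: inner_axis)
  moreover have "l \<bullet> (0, 1) = snd l" by (cases l) simp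
  ultimately show ?thesis
    by (simp add: parabolic_op_def xgrad_def xhess_def tderiv_def clext_inside Q(2,3) linear_0[OF B] vec_eq_iff)
qed

section \<open>The barrier\<close>

text \<open>The power of \<open>z\<close>, up to sign, with respect to the sphere through \<open>0\<close> with centre \<open>m / 2\<close>; positive
  inside. Its gradient is \<open>m - 2 z\<close>.\<close>

definition sphere_defect :: "'n::finite spt \<Rightarrow> 'n spt \<Rightarrow> real" where
  "sphere_defect m z = z \<bullet> m - z \<bullet> z"

definition barrier :: "real \<Rightarrow> 'n::finite spt \<Rightarrow> 'n spt \<Rightarrow> real" where
  "barrier K m z = sphere_defect m z + K * (sphere_defect m z)\<^sup>2"

text \<open>The factor by which the gradient of the barrier exceeds that of \<open>sphere_defect\<close>.\<close>

definition barrier_slope :: "real \<Rightarrow> 'n::finite spt \<Rightarrow> 'n spt \<Rightarrow> real" where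
  "barrier_slope K m z = 1 + 2 * K * sphere_defect m z"

text \<open>The Hessian of the barrier in the \<open>x\<close>-variables minus \<open>4 I\<close>. Half of the loss \<open>4 I\<close> absorbs the
  Taylor remainder of \<open>v\<close>, the other half the third-order terms of the barrier.\<close>

definition barrier_hess :: "real \<Rightarrow> 'n::finite spt \<Rightarrow> 'n spt \<Rightarrow> real ^ 'n ^ 'n" where
  "barrier_hess K m z = (\<chi> i j. 2 * K * (fst (m - 2 *\<^sub>R z) $ i * fst (m - 2 *\<^sub>R z) $ j)
      - (if i = j then 2 * barrier_slope K m z + 4 else 0))"

text \<open>For small \<open>y\<close> the cubic part of \<open>K q\<^sup>2\<close>, namely \<open>- 2 K (\<nabla>q \<bullet> y) |y|\<^sup>2\<close>, is at least \<open>- |y|\<^sup>2\<close>, and the quartic part is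
  nonnegative.\<close>

lemma barrier_lower_expansion:
  assumes K: "K \<ge> 0" and y: "2 * K * \<bar>(m - 2 *\<^sub>R z) \<bullet> y\<bar> \<le> 1"
  shows "barrier K m (z + y) \<ge> barrier K m z + barrier_slope K m z * ((m - 2 *\<^sub>R z) \<bullet> y)
     + K * ((m - 2 *\<^sub>R z) \<bullet> y)\<^sup>2 - (barrier_slope K m z + 1) * (y \<bullet> y)"
proof -
  define a where "a = (m - 2 *\<^sub>R z) \<bullet> y"
  define n where "n = y \<bullet> y"
  have n: "n \<ge> 0" by (simp add: n_def)
  have q: "sphere_defect m (z + y) = sphere_defect m z + a - n"
    by (simp add: sphere_defect_def a_def n_def inner_add_left inner_add_right inner_diff_left inner_diff_right inner_commute)
  have "2 * K * a \<le> 2 * K * \<bar>a\<bar>" using K by (intro mult_left_mono) auto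
  then have "(2 * K * a) * n \<le> 1 * n" using y n by (intro mult_right_mono) (auto simp: a_def)
  moreover have "K * n\<^sup>2 \<ge> 0" using K by simp
  moreover have "barrier K m (z + y) = barrier K m z + barrier_slope K m z * (a - n) + K * a\<^sup>2 - (2 * K * a) * n + K * n\<^sup>2"
    unfolding barrier_def barrier_slope_def q by (simp add: power2_eq_square algebra_simps)
  ultimately have "barrier K m (z + y) \<ge> barrier K m z + barrier_slope K m z * (a - n) + K * a\<^sup>2 - n" by linarith
  then show ?thesis by (simp add: a_def n_def algebra_simps)
qed

lemma linear_inner_scaleR: "linear (\<lambda>y. (\<epsilon> * (c * (g \<bullet> y))) *\<^sub>R (h :: 'a::real_inner))"
  by (intro linearI) (simp_all add: inner_add_right distrib_left scaleR_add_left mult.left_commute)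

lemma linear_scaleR_id: "linear (\<lambda>y. c *\<^sub>R (y :: 'a::real_vector))"
  by (intro linearI) (simp_all add: scaleR_add_right)

lemma inner_bilinear_sum_Basis:
  fixes H :: "'a::euclidean_space \<Rightarrow> 'a \<Rightarrow> real"
  assumes "d \<in> Basis" "e \<in> Basis"
  shows "e \<bullet> (\<Sum>b\<in>Basis. \<Sum>b'\<in>Basis. (H b b' * (d \<bullet> b)) *\<^sub>R b') = H d e"
proof -
  have "e \<bullet> (\<Sum>b\<in>Basis. \<Sum>b'\<in>Basis. (H b b' * (d \<bullet> b)) *\<^sub>R b')
     = (\<Sum>b\<in>Basis. \<Sum>b'\<in>Basis. if b' = e then if b = d then H b b' else 0 else 0)"
    unfolding inner_sum_right using assms by (intro sum.cong refl) (auto simp: inner_Basis)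
  then show ?thesis using assms by simp
qed

text \<open>The test function is the quadratic polynomial with the gradient of \<open>v + \<epsilon> h\<close> at \<open>z1\<close> and its Hessian
  lowered by \<open>4 \<epsilon> I\<close>; it lies below \<open>u\<close> near \<open>z1\<close> by the Taylor estimates for \<open>v\<close> and \<open>h\<close>.\<close>

lemma viscosity_at_barrier_contact:
  fixes F :: "'n::finite nlop"
  assumes \<Omega>: "open \<Omega>" "\<Omega> \<subseteq> {z. snd z < 0}" and S: "S \<subseteq> time_zero"
    and v: "C2_on_closure \<Omega> v" and visc: "viscosity_le F \<Omega> S u v"
    and z1: "z1 \<in> \<Omega> \<union> S" "z1 \<in> closure \<Omega>" and \<epsilon>: "\<epsilon> > 0" and K: "K \<ge> 0"
    and r: "r > 0" "\<And>z. dist z z1 < r \<Longrightarrow> snd z < 0 \<Longrightarrow> z \<in> \<Omega>"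
    and contact: "\<And>z. z \<in> \<Omega> \<union> S \<Longrightarrow> dist z z1 < r \<Longrightarrow>
        u z1 - v z1 - \<epsilon> * barrier K m z1 \<le> u z - v z - \<epsilon> * barrier K m z"
  shows "F z1 (u z1) (xgrad \<Omega> v z1 + (\<epsilon> * barrier_slope K m z1) *\<^sub>R fst (m - 2 *\<^sub>R z1))
        (xhess \<Omega> v z1 + \<epsilon> *\<^sub>R barrier_hess K m z1)
      - tderiv \<Omega> v z1 - \<epsilon> * barrier_slope K m z1 * snd (m - 2 *\<^sub>R z1)
     \<le> parabolic_op F \<Omega> v z1"
proof -
  define g where "g = m - 2 *\<^sub>R z1"
  define \<kappa> where "\<kappa> = barrier_slope K m z1"
  define D where "D b = clext \<Omega> (pd b v) z1" for b
  define H where "H b b' = clext \<Omega> (pd b (pd b' v)) z1" for b b'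
  have Hsym: "H b b' = H b' b" for b b'
    unfolding H_def by (rule clext_pd_commute[OF \<Omega>(1) v z1(2)])
  have tle: "snd z \<le> 0" if "z \<in> \<Omega> \<union> S" for z
    using that \<Omega>(2) S by (auto simp: time_zero_def)
  define l where "l = (\<Sum>b\<in>Basis. D b *\<^sub>R b) + (\<epsilon> * \<kappa>) *\<^sub>R g"
  define T where "T y = (\<Sum>b\<in>Basis. \<Sum>b'\<in>Basis. (H b b' * (y \<bullet> b)) *\<^sub>R b')" for y :: "'n spt"
  define B where "B y = T y + (\<epsilon> * (2 * K * (g \<bullet> y))) *\<^sub>R g - (\<epsilon> * (2 * \<kappa> + 4)) *\<^sub>R y" for y
  have linT: "linear T"
    unfolding T_def
    by (intro linearI) (simp_all add: inner_add_left distrib_left scaleR_add_left sum.distrib scaleR_sum_right mult.left_commute)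
  have linB: "linear B"
    unfolding B_def
    by (intro linear_compose_sub linear_compose_add linT linear_inner_scaleR linear_scaleR_id)
  obtain \<rho> where \<rho>: "\<rho> > 0"
    "\<And>y. norm y < \<rho> \<Longrightarrow> snd (z1 + y) \<le> 0 \<Longrightarrow>
      v (z1 + y) \<ge> v z1 + (\<Sum>b\<in>Basis. (y \<bullet> b) * D b)
        + (\<Sum>b\<in>Basis. \<Sum>b'\<in>Basis. (y \<bullet> b) * (y \<bullet> b') * H b b') / 2 - \<epsilon> * (norm y)\<^sup>2"
    by (rule taylor_lower_bound_from_below[OF \<Omega>(1) v r tle[OF z1(1)] \<epsilon>, folded D_def H_def])
      (assumption+, rule that)
  have pos: "2 * K * norm g + 1 > 0" using K by (simp add: add_nonneg_pos)
  \<comment> \<open>The last bound makes \<open>2 K |g \<bullet> y| \<le> 1\<close>, as the expansion of the barrier requires.\<close>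
  define R where "R = min r (min \<rho> (1 / (2 * K * norm g + 1)))"
  have R: "R > 0" using r \<rho> pos by (simp add: R_def)
  have "F z1 (u z1) (fst l) (\<chi> i j. ((axis i 1, 0) \<bullet> B (axis j 1, 0) + (axis j 1, 0) \<bullet> B (axis i 1, 0)) / 2) - snd l
     \<le> parabolic_op F \<Omega> v z1"
  proof (rule viscosity_at_quadratic_touching[OF visc z1(1) linB R])
    fix z assume z: "z \<in> \<Omega> \<union> S" "dist z z1 < R"
    define y where "y = z - z1"
    have zy: "z = z1 + y" by (simp add: y_def)
    have ny: "norm y < \<rho>" "norm y * (2 * K * norm g + 1) < 1" "dist z z1 < r"
    proof -
      have "norm y < 1 / (2 * K * norm g + 1)" "norm y < \<rho>" "dist z z1 < r"
        using z by (simp_all add: R_def y_def dist_norm)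
      then show "norm y < \<rho>" "norm y * (2 * K * norm g + 1) < 1" "dist z z1 < r"
        using pos_less_divide_eq[OF pos, of "norm y" 1] by simp_all
    qed
    have "2 * K * \<bar>g \<bullet> y\<bar> \<le> 2 * K * (norm g * norm y)"
      using K Cauchy_Schwarz_ineq2[of g y] by (intro mult_left_mono) auto
    also have "\<dots> \<le> norm y * (2 * K * norm g + 1)" by (simp add: algebra_simps)
    finally have small: "2 * K * \<bar>g \<bullet> y\<bar> \<le> 1" using ny by simp
    from barrier_lower_expansion[OF K small[unfolded g_def]]
    have "\<epsilon> * barrier K m z \<ge> \<epsilon> * (barrier K m z1 + \<kappa> * (g \<bullet> y) + K * (g \<bullet> y)\<^sup>2 - (\<kappa> + 1) * (y \<bullet> y))"
      using \<epsilon> unfolding zy g_def \<kappa>_def by (intro mult_left_mono) auto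
    then have 1: "\<epsilon> * barrier K m z \<ge> \<epsilon> * barrier K m z1 + \<epsilon> * \<kappa> * (g \<bullet> y) + \<epsilon> * K * (g \<bullet> y)\<^sup>2 - \<epsilon> * (\<kappa> + 1) * (y \<bullet> y)"
      by (simp add: algebra_simps)
    have 2: "v z \<ge> v z1 + (\<Sum>b\<in>Basis. (y \<bullet> b) * D b)
        + (\<Sum>b\<in>Basis. \<Sum>b'\<in>Basis. (y \<bullet> b) * (y \<bullet> b') * H b b') / 2 - \<epsilon> * (y \<bullet> y)"
      using \<rho>(2)[OF ny(1)] tle[OF z(1)] unfolding zy power2_norm_eq_inner by simp
    have 3: "l \<bullet> y = (\<Sum>b\<in>Basis. (y \<bullet> b) * D b) + \<epsilon> * \<kappa> * (g \<bullet> y)"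
      unfolding l_def inner_add_left inner_sum_left by (simp add: inner_commute[of y] mult.commute)
    have 4: "(y \<bullet> B y) / 2 = (\<Sum>b\<in>Basis. \<Sum>b'\<in>Basis. (y \<bullet> b) * (y \<bullet> b') * H b b') / 2
        + \<epsilon> * K * (g \<bullet> y)\<^sup>2 - \<epsilon> * (\<kappa> + 2) * (y \<bullet> y)"
    proof -
      have "y \<bullet> T y = (\<Sum>b\<in>Basis. \<Sum>b'\<in>Basis. (y \<bullet> b) * (y \<bullet> b') * H b b')"
        unfolding T_def inner_sum_right by (intro sum.cong refl) simp
      moreover have "y \<bullet> B y = y \<bullet> T y + \<epsilon> * (2 * K * (g \<bullet> y)) * (g \<bullet> y) - \<epsilon> * (2 * \<kappa> + 4) * (y \<bullet> y)"
        by (simp add: B_def inner_add_right inner_diff_right inner_commute[of y g])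
      ultimately show ?thesis by (simp add: power2_eq_square algebra_simps)
    qed
    have 5: "\<epsilon> * (\<kappa> + 2) * (y \<bullet> y) = \<epsilon> * (\<kappa> + 1) * (y \<bullet> y) + \<epsilon> * (y \<bullet> y)" by (simp add: algebra_simps)
    show "u z1 + l \<bullet> (z - z1) + ((z - z1) \<bullet> B (z - z1)) / 2 \<le> u z"
      using contact[OF z(1) ny(3)] 1 2 5 unfolding y_def[symmetric] 3 4 by linarith
  qed
  moreover have "fst l = xgrad \<Omega> v z1 + (\<epsilon> * \<kappa>) *\<^sub>R fst g"
  proof (subst vec_eq_iff, intro allI)
    fix i
    have b: "(axis i 1, 0) \<in> (Basis :: 'n spt set)" by (auto simp: Basis_prod_def axis_in_Basis_iff)
    have "fst l $ i = l \<bullet> (axis i 1, 0)" by (cases l) (simp add: inner_axis)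
    also have "\<dots> = D (axis i 1, 0) + \<epsilon> * \<kappa> * (g \<bullet> (axis i 1, 0))"
      by (simp only: l_def inner_add_left inner_scaleR_left inner_sum_left_Basis[OF b])
    also have "g \<bullet> (axis i 1, 0) = fst g $ i" by (cases g) (simp add: inner_axis)
    finally show "fst l $ i = (xgrad \<Omega> v z1 + (\<epsilon> * \<kappa>) *\<^sub>R fst g) $ i" by (simp add: D_def xgrad_def)
  qed
  moreover have "snd l = tderiv \<Omega> v z1 + \<epsilon> * \<kappa> * snd g"
  proof -
    have b: "(0, 1) \<in> (Basis :: 'n spt set)" by (auto simp: Basis_prod_def)
    have "snd l = l \<bullet> (0, 1)" by (cases l) simp
    also have "\<dots> = D (0, 1) + \<epsilon> * \<kappa> * (g \<bullet> (0, 1))"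
      by (simp only: l_def inner_add_left inner_scaleR_left inner_sum_left_Basis[OF b])
    also have "g \<bullet> (0, 1) = snd g" by (cases g) simp
    finally show ?thesis by (simp add: D_def tderiv_def)
  qed
  moreover have "(\<chi> i j. ((axis i 1, 0) \<bullet> B (axis j 1, 0) + (axis j 1, 0) \<bullet> B (axis i 1, 0)) / 2)
      = xhess \<Omega> v z1 + \<epsilon> *\<^sub>R barrier_hess K m z1"
  proof (subst vec_eq_iff, subst vec_eq_iff, intro allI)
    fix i j
    have b: "(axis i 1, 0) \<in> (Basis :: 'n spt set)" for i by (auto simp: Basis_prod_def axis_in_Basis_iff)
    have g: "g \<bullet> (axis i 1, 0) = fst g $ i" "(axis i 1, 0) \<bullet> g = fst g $ i" for i
      by (cases g, simp add: inner_axis inner_commute)+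
    have ee: "(axis i (1::real), 0) \<bullet> (axis j (1::real), 0 :: real) = (if i = j then 1 else 0 :: real)" for i j :: 'n
      by (simp add: inner_axis_axis)
    have BB: "(axis i 1, 0) \<bullet> B (axis j 1, 0) = H (axis j 1, 0) (axis i 1, 0)
       + \<epsilon> * (2 * K * (fst g $ i * fst g $ j)) - \<epsilon> * (if i = j then 2 * \<kappa> + 4 else 0)" for i j
      unfolding B_def inner_add_right inner_diff_right inner_scaleR_right g ee T_def
        inner_bilinear_sum_Basis[OF b b] by simp
    have swap: "fst g $ j * fst g $ i = fst g $ i * fst g $ j"
      "(if j = i then 2 * \<kappa> + 4 else 0) = (if i = j then 2 * \<kappa> + 4 else 0)"
      by auto
    have "((axis i 1, 0) \<bullet> B (axis j 1, 0) + (axis j 1, 0) \<bullet> B (axis i 1, 0)) / 2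
       = H (axis i 1, 0) (axis j 1, 0) + \<epsilon> * (2 * K * (fst g $ i * fst g $ j) - (if i = j then 2 * \<kappa> + 4 else 0))"
      unfolding BB Hsym[of "(axis j 1, 0)" "(axis i 1, 0)"] swap by (simp add: right_diff_distrib)
    then show "(\<chi> i j. ((axis i 1, 0) \<bullet> B (axis j 1, 0) + (axis j 1, 0) \<bullet> B (axis i 1, 0)) / 2) $ i $ j
      = (xhess \<Omega> v z1 + \<epsilon> *\<^sub>R barrier_hess K m z1) $ i $ j"
      by (simp add: xhess_def barrier_hess_def H_def g_def \<kappa>_def)
  qed
  ultimately show ?thesis by (simp add: g_def \<kappa>_def)
qed

section \<open>Comparison near the origin\<close>

lemma norm_matrix_le_sum: "norm (M :: real ^ 'n ^ 'n) \<le> (\<Sum>i\<in>UNIV. \<Sum>j\<in>UNIV. \<bar>M $ i $ j\<bar>)"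
proof -
  have "norm M \<le> (\<Sum>i\<in>UNIV. norm (M $ i))"
    unfolding norm_vec_def by (intro L2_set_le_sum) auto
  also have "\<dots> \<le> (\<Sum>i\<in>UNIV. \<Sum>j\<in>UNIV. \<bar>M $ i $ j\<bar>)"
    by (intro sum_mono norm_le_l1_cart)
  finally show ?thesis .
qed

lemma barrier_hess_symmetric: "barrier_hess K m z \<in> sym_matrices"
  unfolding sym_matrices_iff barrier_hess_def vec_lambda_beta by (auto simp: mult.commute)

lemma xhess_symmetric:
  assumes "open \<Omega>" "C2_on_closure \<Omega> v" "z \<in> closure \<Omega>"
  shows "xhess \<Omega> v z \<in> sym_matrices"
  unfolding sym_matrices_iff xhess_def vec_lambda_beta using clext_pd_commute[OF assms] by blast

lemma continuous_on_jet:
  assumes v: "C2_on_closure \<Omega> v"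
  shows "continuous_on (closure \<Omega>) (\<lambda>z. (v z, xgrad \<Omega> v z, xhess \<Omega> v z))"
proof -
  have "continuous_on (closure \<Omega>) (\<lambda>z. xgrad \<Omega> v z)"
    unfolding xgrad_def using v by (intro continuous_on_vec_lambda) (simp add: C2_on_closure_def)
  moreover have "continuous_on (closure \<Omega>) (\<lambda>z. xhess \<Omega> v z)"
    unfolding xhess_def using v by (intro continuous_on_vec_lambda) (simp add: C2_on_closure_def)
  ultimately show ?thesis using v by (intro continuous_intros) (auto simp: C2_on_closure_def)
qed

text \<open>On \<open>sphere_defect m z \<ge> 0\<close> this measures the barrier together with the derivatives that enter \<open>F\<close>;
  the error of the frozen linearisation is proportional to it.\<close>

definition barrier_size :: "real \<Rightarrow> 'n::finite spt \<Rightarrow> 'n spt \<Rightarrow> real" where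
  "barrier_size K m z = barrier K m z + (\<Sum>i\<in>UNIV. \<bar>barrier_slope K m z * fst (m - 2 *\<^sub>R z) $ i\<bar>)
     + (\<Sum>i\<in>UNIV. \<Sum>j\<in>UNIV. \<bar>barrier_hess K m z $ i $ j\<bar>)"

lemma continuous_barrier [continuous_intros]:
  "continuous_on A (\<lambda>z. barrier K m z)" "continuous_on A (\<lambda>z. barrier_slope K m z)"
  "continuous_on A (\<lambda>z. barrier_hess K m z $ i $ j)" "continuous_on A (\<lambda>z. barrier_size K m z)"
  "continuous_on A (\<lambda>z. sphere_defect m z)"
proof -
  show q: "continuous_on A (\<lambda>z. sphere_defect m z)"
    unfolding sphere_defect_def by (intro continuous_intros)
  show b: "continuous_on A (\<lambda>z. barrier K m z)"
    unfolding barrier_def by (intro continuous_intros q)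
  show s: "continuous_on A (\<lambda>z. barrier_slope K m z)"
    unfolding barrier_slope_def by (intro continuous_intros q)
  show h: "continuous_on A (\<lambda>z. barrier_hess K m z $ i $ j)" for i j
    unfolding barrier_hess_def vec_lambda_beta by (cases "i = j") (auto intro!: continuous_intros s)
  show "continuous_on A (\<lambda>z. barrier_size K m z)"
    unfolding barrier_size_def by (intro continuous_intros b s h)
qed

lemma barrier_nonneg: "K \<ge> 0 \<Longrightarrow> sphere_defect m z \<ge> 0 \<Longrightarrow> barrier K m z \<ge> sphere_defect m z"
  by (simp add: barrier_def)

lemma barrier_size_bounds:
  assumes K: "K \<ge> 0" and q: "sphere_defect m z \<ge> 0" and s: "0 \<le> s" "s \<le> \<epsilon> * barrier K m z" and \<epsilon>: "\<epsilon> > 0"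
  shows "barrier K m z \<le> barrier_size K m z"
    "norm (s, (\<epsilon> * barrier_slope K m z) *\<^sub>R fst (m - 2 *\<^sub>R z), \<epsilon> *\<^sub>R barrier_hess K m z) \<le> \<epsilon> * barrier_size K m z"
proof -
  let ?p = "barrier_slope K m z *\<^sub>R fst (m - 2 *\<^sub>R z)" and ?N = "barrier_hess K m z"
  show "barrier K m z \<le> barrier_size K m z"
    unfolding barrier_size_def by (simp add: sum_nonneg add_nonneg_nonneg)
  have "norm (s, \<epsilon> *\<^sub>R ?p, \<epsilon> *\<^sub>R ?N) \<le> norm s + norm (\<epsilon> *\<^sub>R ?p, \<epsilon> *\<^sub>R ?N)" by (rule norm_Pair_le)
  also have "\<dots> \<le> norm s + (norm (\<epsilon> *\<^sub>R ?p) + norm (\<epsilon> *\<^sub>R ?N))" by (intro add_left_mono norm_Pair_le)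
  also have "norm (\<epsilon> *\<^sub>R ?p) = \<epsilon> * norm ?p" using \<epsilon> by (simp add: abs_mult)
  also have "norm (\<epsilon> *\<^sub>R ?N) = \<epsilon> * norm ?N" using \<epsilon> by simp
  also have "norm s + (\<epsilon> * norm ?p + \<epsilon> * norm ?N) \<le> \<epsilon> * barrier K m z +
     (\<epsilon> * (\<Sum>i\<in>UNIV. \<bar>?p $ i\<bar>) + \<epsilon> * (\<Sum>i\<in>UNIV. \<Sum>j\<in>UNIV. \<bar>?N $ i $ j\<bar>))"
    using s \<epsilon> norm_le_l1_cart[of ?p] norm_matrix_le_sum[of ?N] by (intro add_mono mult_left_mono) auto
  also have "\<dots> = \<epsilon> * barrier_size K m z" by (simp add: barrier_size_def algebra_simps)
  finally show "norm (s, (\<epsilon> * barrier_slope K m z) *\<^sub>R fst (m - 2 *\<^sub>R z), \<epsilon> *\<^sub>R barrier_hess K m z) \<le> \<epsilon> * barrier_size K m z"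
    by simp
qed

text \<open>Here \<open>a\<close>, \<open>b\<close>, \<open>c\<close> are the frozen coefficients of second, first and zeroth order. By continuity it
  suffices to have the strict inequality at \<open>z = 0\<close>, where the barrier vanishes and the left-hand side
  of it is \<open>snd m + \<omega> * barrier_size K m 0\<close>. Choose \<open>K\<close> large, then \<open>\<omega>\<close> small. The zeroth-order
  coefficient enters through \<open>\<bar>c\<bar> * barrier K m z\<close> because the increment of \<open>s\<close> will only be known
  to lie between \<open>0\<close> and a multiple of the barrier.\<close>

lemma barrier_strict_subsolution_near_zero:
  fixes a :: "real ^ 'n ^ 'n" and b :: "real ^ 'n" and m :: "'n::finite spt"
  assumes a: "fst m \<bullet> (a *v fst m) > 0"
  obtains K \<omega> \<delta> where "K > 0" "\<omega> > 0" "\<delta> > 0"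
    "\<And>z. norm z < \<delta> \<Longrightarrow> barrier_size K m z < barrier_size K m 0 + 1 \<and>
      barrier_slope K m z * snd (m - 2 *\<^sub>R z) + \<omega> * barrier_size K m z + \<bar>c\<bar> * barrier K m z
       < (\<Sum>i\<in>UNIV. barrier_slope K m z * fst (m - 2 *\<^sub>R z) $ i * b $ i)
         + (\<Sum>i\<in>UNIV. \<Sum>j\<in>UNIV. barrier_hess K m z $ i $ j * a $ i $ j)"
proof -
  define \<alpha> where "\<alpha> = fst m \<bullet> (a *v fst m)"
  define \<beta> where "\<beta> = (\<Sum>i\<in>UNIV. fst m $ i * b $ i)"
  define t where "t = (\<Sum>i\<in>UNIV. a $ i $ i)"
  \<comment> \<open>At \<open>0\<close> the linearised operator applied to the barrier gives \<open>2 K \<alpha> - 6 t + \<beta> - snd m\<close>: the Hessian is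
    \<open>2 K \<nabla>q \<otimes> \<nabla>q - 2 I\<close>, minus the loss \<open>4 I\<close>.\<close>
  define K where "K = (1 + \<bar>6 * t\<bar> + \<bar>\<beta>\<bar> + \<bar>snd m\<bar>) / (2 * \<alpha>)"
  have \<alpha>: "\<alpha> > 0" using a by (simp add: \<alpha>_def)
  have num: "1 + \<bar>6 * t\<bar> + \<bar>\<beta>\<bar> + \<bar>snd m\<bar> > 0" by (simp add: add_pos_nonneg)
  have K: "K > 0" "2 * K * \<alpha> = 1 + \<bar>6 * t\<bar> + \<bar>\<beta>\<bar> + \<bar>snd m\<bar>"
    using \<alpha> num by (simp_all add: K_def)
  have q0: "sphere_defect m 0 = 0" "barrier K m 0 = 0" "barrier_slope K m 0 = 1"
    by (simp_all add: sphere_defect_def barrier_def barrier_slope_def)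
  have size0: "barrier_size K m 0 \<ge> 0" unfolding barrier_size_def q0 by (simp add: sum_nonneg)
  define \<omega> where "\<omega> = 1 / (2 * (barrier_size K m 0 + 1))"
  have \<omega>: "\<omega> > 0" using size0 by (simp add: \<omega>_def)
  have \<omega>s: "\<omega> * barrier_size K m 0 < 1" using size0 by (simp add: \<omega>_def divide_simps)
  define \<Psi> where "\<Psi> z = (\<Sum>i\<in>UNIV. barrier_slope K m z * fst (m - 2 *\<^sub>R z) $ i * b $ i)
         + (\<Sum>i\<in>UNIV. \<Sum>j\<in>UNIV. barrier_hess K m z $ i $ j * a $ i $ j)
         - (barrier_slope K m z * snd (m - 2 *\<^sub>R z) + \<omega> * barrier_size K m z + \<bar>c\<bar> * barrier K m z)" for z
  have "(\<Sum>i\<in>UNIV. \<Sum>j\<in>UNIV. barrier_hess K m 0 $ i $ j * a $ i $ j) = 2 * K * \<alpha> - 6 * t"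
  proof -
    have "barrier_hess K m 0 $ i $ j * a $ i $ j = 2 * K * (fst m $ i * (a $ i $ j * fst m $ j))
       - (if j = i then 6 * a $ i $ i else 0)" for i j
      by (simp add: barrier_hess_def q0 algebra_simps)
    then have "(\<Sum>i\<in>UNIV. \<Sum>j\<in>UNIV. barrier_hess K m 0 $ i $ j * a $ i $ j)
      = 2 * K * (\<Sum>i\<in>UNIV. fst m $ i * (\<Sum>j\<in>UNIV. a $ i $ j * fst m $ j)) - (\<Sum>i\<in>UNIV. 6 * a $ i $ i)"
      by (simp add: sum_subtractf sum_distrib_left)
    then show ?thesis by (simp add: \<alpha>_def t_def inner_vec_def matrix_vector_mult_def sum_distrib_left)
  qed
  then have "\<Psi> 0 = \<beta> + (2 * K * \<alpha> - 6 * t) - (snd m + \<omega> * barrier_size K m 0)"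
    by (simp add: \<Psi>_def q0 \<beta>_def)
  then have \<Psi>0: "\<Psi> 0 > 0" unfolding K(2) using \<omega>s by linarith
  have cont: "continuous_on UNIV \<Psi>" unfolding \<Psi>_def by (intro continuous_intros)
  obtain d1 where d1: "d1 > 0" "\<And>z. dist z 0 < d1 \<Longrightarrow> dist (\<Psi> z) (\<Psi> 0) < \<Psi> 0"
    using continuous_on_near_point[OF cont UNIV_I \<Psi>0, of 0] by auto
  have cont2: "continuous_on UNIV (\<lambda>z. barrier_size K m z)" by (intro continuous_intros)
  obtain d2 where d2: "d2 > 0" "\<And>z. dist z 0 < d2 \<Longrightarrow> dist (barrier_size K m z) (barrier_size K m 0) < 1"
    using continuous_on_near_point[OF cont2 UNIV_I zero_less_one, of 0] by auto
  show thesis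
  proof (rule that[OF K(1) \<omega>, of "min d1 d2"])
    show "min d1 d2 > 0" using d1 d2 by simp
    fix z :: "'n spt" assume z: "norm z < min d1 d2"
    have "\<Psi> z > 0" using d1(2)[of z] z by (simp add: dist_real_def abs_less_iff)
    moreover have "barrier_size K m z < barrier_size K m 0 + 1"
      using d2(2)[of z] z by (simp add: dist_real_def abs_less_iff)
    ultimately show "barrier_size K m z < barrier_size K m 0 + 1 \<and>
      barrier_slope K m z * snd (m - 2 *\<^sub>R z) + \<omega> * barrier_size K m z + \<bar>c\<bar> * barrier K m z
       < (\<Sum>i\<in>UNIV. barrier_slope K m z * fst (m - 2 *\<^sub>R z) $ i * b $ i)
         + (\<Sum>i\<in>UNIV. \<Sum>j\<in>UNIV. barrier_hess K m z $ i $ j * a $ i $ j)"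
      by (simp add: \<Psi>_def)
  qed
qed

text \<open>Minimise \<open>u - v - \<epsilon> h\<close> over the closed ball cut by \<open>t \<le> 0\<close> and \<open>|z| \<le> \<delta>\<close>. On the sphere \<open>h = 0\<close>
  and \<open>u \<ge> v\<close>; on \<open>|z| = \<delta>\<close> the difference \<open>u - v\<close> has a positive minimum \<open>\<eta>\<close>, and \<open>\<epsilon>\<close> is so small that
  \<open>\<epsilon> h \<le> \<eta>\<close>. A negative minimum is therefore attained at a contact point in \<open>\<Omega> \<union> S\<close>, where the
  viscosity inequality and the lower bound for the increment of \<open>F\<close> exclude each other.\<close>

lemma growth_from_interior_ball:
  fixes F :: "'n::finite nlop"
  assumes \<Omega>: "open \<Omega>" "\<Omega> \<subseteq> {z. snd z < 0}" and S: "S \<subseteq> time_zero" "S \<subseteq> closure \<Omega>"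
    and F: "C1_in_spM (closure \<Omega>) F"
      "\<And>z s p M. z \<in> closure \<Omega> \<Longrightarrow> M \<in> sym_matrices \<Longrightarrow> positive_definite (deriv_M F z s p M)"
    and u: "lsc_on (closure \<Omega>) u" and v: "C2_on_closure \<Omega> v" and visc: "viscosity_le F \<Omega> S u v"
    and ge: "\<And>z. z \<in> closure \<Omega> \<Longrightarrow> u z \<ge> v z" and gt: "\<And>z. z \<in> \<Omega> \<union> S \<Longrightarrow> u z > v z"
    and zero: "0 \<in> closure \<Omega>" and m: "fst m \<noteq> 0"
    and ball: "\<And>z. z \<noteq> 0 \<Longrightarrow> z \<bullet> z \<le> z \<bullet> m \<Longrightarrow> snd z \<le> 0 \<Longrightarrow> z \<in> \<Omega> \<union> S"
  obtains \<epsilon> \<delta> where "\<epsilon> > 0" "\<delta> > 0"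
    "\<And>z. snd z \<le> 0 \<Longrightarrow> norm z \<le> \<delta> \<Longrightarrow> sphere_defect m z \<ge> 0 \<Longrightarrow> \<epsilon> * sphere_defect m z \<le> u z - v z"
proof -
  define s0 where "s0 = v 0"
  define p0 where "p0 = xgrad \<Omega> v 0"
  define M0 where "M0 = xhess \<Omega> v 0"
  have M0: "M0 \<in> sym_matrices" unfolding M0_def by (rule xhess_symmetric[OF \<Omega>(1) v zero])
  let ?c = "deriv_s F 0 s0 p0 M0" and ?b = "deriv_p F 0 s0 p0 M0" and ?a = "deriv_M F 0 s0 p0 M0"
  have pos: "fst m \<bullet> (?a *v fst m) > 0" using F(2)[OF zero M0] m by (simp add: positive_definite_def)
  obtain K \<omega> \<delta>1 where K: "K > 0" and \<omega>: "\<omega> > 0" and \<delta>1: "\<delta>1 > 0"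
    "\<And>z. norm z < \<delta>1 \<Longrightarrow> barrier_size K m z < barrier_size K m 0 + 1 \<and>
      barrier_slope K m z * snd (m - 2 *\<^sub>R z) + \<omega> * barrier_size K m z + \<bar>?c\<bar> * barrier K m z
       < (\<Sum>i\<in>UNIV. barrier_slope K m z * fst (m - 2 *\<^sub>R z) $ i * ?b $ i)
         + (\<Sum>i\<in>UNIV. \<Sum>j\<in>UNIV. barrier_hess K m z $ i $ j * ?a $ i $ j)"
    by (rule barrier_strict_subsolution_near_zero[OF pos]) (rule that)
  obtain r where r: "r > 0"
    and incr: "\<And>z s p M s' p' M'. z \<in> closure \<Omega> \<Longrightarrow> dist z 0 < r \<Longrightarrow> M \<in> sym_matrices \<Longrightarrow> M' \<in> sym_matrices \<Longrightarrow>
     dist (s, p, M) (s0, p0, M0) < r \<Longrightarrow> norm (s', p', M') < r \<Longrightarrow>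
     F z (s + s') (p + p') (M + M') - F z s p M
      \<ge> s' * ?c + (\<Sum>i\<in>UNIV. p' $ i * ?b $ i) + (\<Sum>i\<in>UNIV. \<Sum>j\<in>UNIV. M' $ i $ j * ?a $ i $ j)
        - \<omega> * (\<bar>s'\<bar> + (\<Sum>i\<in>UNIV. \<bar>p' $ i\<bar>) + (\<Sum>i\<in>UNIV. \<Sum>j\<in>UNIV. \<bar>M' $ i $ j\<bar>))"
    by (rule operator_increment_lower_bound[OF F(1) zero M0 \<omega>]) (rule that)
  obtain \<delta>2 where \<delta>2: "\<delta>2 > 0" "\<And>z. z \<in> closure \<Omega> \<Longrightarrow> dist z 0 < \<delta>2 \<Longrightarrow>
       dist (v z, xgrad \<Omega> v z, xhess \<Omega> v z) (s0, p0, M0) < r"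
    by (rule continuous_on_near_point[OF continuous_on_jet[OF v] zero r, folded s0_def p0_def M0_def]) (rule that)
  define \<delta> where "\<delta> = min \<delta>1 (min \<delta>2 r) / 2"
  have \<delta>: "\<delta> > 0" "\<delta> < \<delta>1" "\<delta> < \<delta>2" "\<delta> < r" using \<delta>1 \<delta>2 r by (auto simp: \<delta>_def)
  define G where "G = {z. snd z \<le> 0} \<inter> {z. 0 \<le> sphere_defect m z} \<inter> cball 0 \<delta>"
  have G0: "z \<in> \<Omega> \<union> S" if "z \<in> G" "z \<noteq> 0" for z
    using ball[OF that(2)] that(1) by (simp add: G_def sphere_defect_def)
  have Gc: "G \<subseteq> closure \<Omega>" using G0 S(2) closure_subset zero by blast
  have "closed {z :: 'n spt. snd z \<le> 0}" "closed {z. 0 \<le> sphere_defect m z}"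
    by (intro closed_Collect_le continuous_intros)+
  then have compG: "compact G" unfolding G_def by (intro closed_Int_compact closed_Int compact_cball)
  define \<Gamma> where "\<Gamma> = G \<inter> sphere 0 \<delta>"
  have comp\<Gamma>: "compact \<Gamma>" unfolding \<Gamma>_def by (intro compact_Int_closed compG closed_sphere)
  have cv: "continuous_on (closure \<Omega>) v" using v by (simp add: C2_on_closure_def)
  obtain \<eta> where \<eta>: "\<eta> > 0" "\<And>z. z \<in> \<Gamma> \<Longrightarrow> \<eta> \<le> u z - v z"
  proof (cases "\<Gamma> = {}")
    case True
    then show thesis using that[of 1] by simp
  next
    case False
    have sub: "\<Gamma> \<subseteq> closure \<Omega>" using Gc by (auto simp: \<Gamma>_def)
    obtain z where z: "z \<in> \<Gamma>" "\<And>y. y \<in> \<Gamma> \<Longrightarrow> u z - v z \<le> u y - v y"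
      using lsc_minus_continuous_attains_min[OF comp\<Gamma> False sub u continuous_on_subset[OF cv sub]] by blast
    have "z \<in> \<Omega> \<union> S" using z(1) \<delta>(1) by (intro G0) (auto simp: \<Gamma>_def)
    from gt[OF this] show thesis using that[of "u z - v z"] z(2) by simp
  qed
  define Z where "Z = barrier_size K m 0 + 1"
  have Z: "Z > 0"
    unfolding Z_def barrier_size_def by (simp add: barrier_def sphere_defect_def sum_nonneg add_nonneg_pos)
  have sizeG: "barrier_size K m z < Z" if "z \<in> G" for z
    using \<delta>1(2)[of z] that \<delta> by (simp add: G_def Z_def)
  \<comment> \<open>The bound by \<open>\<eta>\<close> handles \<open>|z| = \<delta>\<close>; the one by \<open>r\<close> keeps the increments of the arguments of \<open>F\<close>
    in the range of \<open>incr\<close>.\<close>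
  define \<epsilon> where "\<epsilon> = min \<eta> r / Z"
  have \<epsilon>: "\<epsilon> > 0" "\<epsilon> * Z \<le> \<eta>" "\<epsilon> * Z \<le> r" using \<eta> r Z by (simp_all add: \<epsilon>_def)
  have qG: "sphere_defect m z \<ge> 0" "barrier K m z \<ge> sphere_defect m z" if "z \<in> G" for z
    using that barrier_nonneg[of K m z] K by (auto simp: G_def)
  have claim: "\<epsilon> * barrier K m z \<le> u z - v z" if zG: "z \<in> G" for z
  proof (rule ccontr)
    assume neg: "\<not> ?thesis"
    have ne: "G \<noteq> {}" using zG by blast
    have cw: "continuous_on G (\<lambda>z. v z + \<epsilon> * barrier K m z)"
      by (intro continuous_intros continuous_on_subset[OF cv Gc])
    obtain z1 where z1: "z1 \<in> G" "\<And>y. y \<in> G \<Longrightarrow>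
        u z1 - (v z1 + \<epsilon> * barrier K m z1) \<le> u y - (v y + \<epsilon> * barrier K m y)"
      using lsc_minus_continuous_attains_min[OF compG ne Gc u cw] by blast
    have low: "u z1 - v z1 < \<epsilon> * barrier K m z1" using z1(2)[OF zG] neg by linarith
    have z1c: "z1 \<in> closure \<Omega>" using z1 Gc by blast
    have qpos: "sphere_defect m z1 > 0"
    proof (rule ccontr)
      assume "\<not> ?thesis"
      then have "sphere_defect m z1 = 0" using qG(1)[OF z1(1)] by simp
      then have "barrier K m z1 = 0" by (simp add: barrier_def)
      then show False using low ge[OF z1c] by simp
    qed
    have inner: "norm z1 < \<delta>"
    proof (rule ccontr)
      assume "\<not> ?thesis"
      then have "z1 \<in> \<Gamma>" using z1(1) by (auto simp: \<Gamma>_def G_def)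
      then have "\<eta> \<le> u z1 - v z1" by (rule \<eta>(2))
      also have "\<dots> < \<epsilon> * barrier K m z1" by (rule low)
      also have "\<dots> \<le> \<epsilon> * Z" using barrier_size_bounds(1)[of K m z1 0 \<epsilon>] sizeG[OF z1(1)] qG[OF z1(1)] K \<epsilon>(1)
        by (intro mult_left_mono) auto
      finally show False using \<epsilon>(2) by simp
    qed
    have z1ne: "z1 \<noteq> 0" using qpos by (auto simp: sphere_defect_def)
    have z1in: "z1 \<in> \<Omega> \<union> S" by (rule G0[OF z1(1) z1ne])
    have "open ({z. 0 < sphere_defect m z} \<inter> ball 0 \<delta>)"
      by (intro open_Int open_ball open_Collect_less continuous_intros)
    moreover have "z1 \<in> {z. 0 < sphere_defect m z} \<inter> ball 0 \<delta>" using qpos inner by simp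
    ultimately obtain r1 where r1: "r1 > 0" "ball z1 r1 \<subseteq> {z. 0 < sphere_defect m z} \<inter> ball 0 \<delta>"
      unfolding open_contains_ball by blast
    have nearG: "z \<in> G \<and> z \<noteq> 0" if "dist z z1 < r1" "snd z \<le> 0" for z
    proof -
      have "z \<in> ball z1 r1" using that by (simp add: dist_commute)
      then have "z \<in> {z. 0 < sphere_defect m z} \<inter> ball 0 \<delta>" using r1 by blast
      then show ?thesis using that by (auto simp: G_def sphere_defect_def)
    qed
    have half: "z \<in> \<Omega>" if "dist z z1 < r1" "snd z < 0" for z
      using G0[of z] nearG[of z] that S(1) by (auto simp: time_zero_def)
    have contact: "u z1 - v z1 - \<epsilon> * barrier K m z1 \<le> u z - v z - \<epsilon> * barrier K m z"
      if "z \<in> \<Omega> \<union> S" "dist z z1 < r1" for z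
    proof -
      have "snd z \<le> 0" using that(1) \<Omega>(2) S(1) by (auto simp: time_zero_def)
      then have "z \<in> G" using nearG that by blast
      from z1(2)[OF this] show ?thesis by simp
    qed
    let ?s = "u z1 - v z1" and ?p = "(\<epsilon> * barrier_slope K m z1) *\<^sub>R fst (m - 2 *\<^sub>R z1)"
      and ?M = "\<epsilon> *\<^sub>R barrier_hess K m z1"
    have "F z1 (u z1) (xgrad \<Omega> v z1 + ?p) (xhess \<Omega> v z1 + ?M)
      - tderiv \<Omega> v z1 - \<epsilon> * barrier_slope K m z1 * snd (m - 2 *\<^sub>R z1) \<le> parabolic_op F \<Omega> v z1"
      by (rule viscosity_at_barrier_contact[OF \<Omega> S(1) v visc z1in z1c \<epsilon>(1) less_imp_le[OF K] r1(1) half contact])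
    then have upper: "F z1 (v z1 + ?s) (xgrad \<Omega> v z1 + ?p) (xhess \<Omega> v z1 + ?M) - F z1 (v z1) (xgrad \<Omega> v z1) (xhess \<Omega> v z1)
       \<le> \<epsilon> * barrier_slope K m z1 * snd (m - 2 *\<^sub>R z1)"
      by (simp add: parabolic_op_def)
    have s: "0 \<le> ?s" "?s \<le> \<epsilon> * barrier K m z1" using ge[OF z1c] low by simp_all
    have "norm (?s, ?p, ?M) \<le> \<epsilon> * barrier_size K m z1"
      by (rule barrier_size_bounds(2)[OF less_imp_le[OF K] qG(1)[OF z1(1)] s \<epsilon>(1)])
    also have "\<dots> < \<epsilon> * Z" using sizeG[OF z1(1)] \<epsilon>(1) by simp
    finally have small: "norm (?s, ?p, ?M) < r" using \<epsilon>(3) by linarith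
    have "F z1 (v z1 + ?s) (xgrad \<Omega> v z1 + ?p) (xhess \<Omega> v z1 + ?M) - F z1 (v z1) (xgrad \<Omega> v z1) (xhess \<Omega> v z1)
      \<ge> ?s * ?c + (\<Sum>i\<in>UNIV. ?p $ i * ?b $ i) + (\<Sum>i\<in>UNIV. \<Sum>j\<in>UNIV. ?M $ i $ j * ?a $ i $ j)
        - \<omega> * (\<bar>?s\<bar> + (\<Sum>i\<in>UNIV. \<bar>?p $ i\<bar>) + (\<Sum>i\<in>UNIV. \<Sum>j\<in>UNIV. \<bar>?M $ i $ j\<bar>))"
      using inner \<delta>
      by (intro incr z1c xhess_symmetric[OF \<Omega>(1) v z1c] sym_matrices_scaleR barrier_hess_symmetric \<delta>2(2) small) auto
    moreover have "?s * ?c \<ge> - (\<epsilon> * (\<bar>?c\<bar> * barrier K m z1))"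
    proof -
      have "\<bar>?s * ?c\<bar> \<le> (\<epsilon> * barrier K m z1) * \<bar>?c\<bar>"
        unfolding abs_mult using s by (intro mult_right_mono) auto
      then show ?thesis by (simp add: abs_le_iff ac_simps)
    qed
    moreover have "(\<Sum>i\<in>UNIV. ?p $ i * ?b $ i) = \<epsilon> * (\<Sum>i\<in>UNIV. barrier_slope K m z1 * fst (m - 2 *\<^sub>R z1) $ i * ?b $ i)"
      by (simp add: sum_distrib_left mult.assoc)
    moreover have "(\<Sum>i\<in>UNIV. \<Sum>j\<in>UNIV. ?M $ i $ j * ?a $ i $ j)
       = \<epsilon> * (\<Sum>i\<in>UNIV. \<Sum>j\<in>UNIV. barrier_hess K m z1 $ i $ j * ?a $ i $ j)"
      by (simp add: sum_distrib_left mult.assoc)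
    moreover have "\<omega> * (\<bar>?s\<bar> + (\<Sum>i\<in>UNIV. \<bar>?p $ i\<bar>) + (\<Sum>i\<in>UNIV. \<Sum>j\<in>UNIV. \<bar>?M $ i $ j\<bar>))
       \<le> \<epsilon> * (\<omega> * barrier_size K m z1)"
    proof -
      have "\<bar>?s\<bar> + (\<Sum>i\<in>UNIV. \<bar>?p $ i\<bar>) + (\<Sum>i\<in>UNIV. \<Sum>j\<in>UNIV. \<bar>?M $ i $ j\<bar>)
        \<le> \<epsilon> * barrier K m z1 + \<epsilon> * (\<Sum>i\<in>UNIV. \<bar>barrier_slope K m z1 * fst (m - 2 *\<^sub>R z1) $ i\<bar>)
          + \<epsilon> * (\<Sum>i\<in>UNIV. \<Sum>j\<in>UNIV. \<bar>barrier_hess K m z1 $ i $ j\<bar>)"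
        using s \<epsilon>(1) by (simp add: sum_distrib_left abs_mult mult.assoc)
      also have "\<dots> = \<epsilon> * barrier_size K m z1" by (simp add: barrier_size_def distrib_left)
      finally show ?thesis using \<omega> by (simp add: mult.left_commute[of \<epsilon> \<omega>] mult_left_mono)
    qed
    moreover have "\<epsilon> * (barrier_slope K m z1 * snd (m - 2 *\<^sub>R z1) + \<omega> * barrier_size K m z1 + \<bar>?c\<bar> * barrier K m z1)
       < \<epsilon> * ((\<Sum>i\<in>UNIV. barrier_slope K m z1 * fst (m - 2 *\<^sub>R z1) $ i * ?b $ i)
         + (\<Sum>i\<in>UNIV. \<Sum>j\<in>UNIV. barrier_hess K m z1 $ i $ j * ?a $ i $ j))"
      using \<delta>1(2)[of z1] inner \<delta> \<epsilon>(1) by (intro mult_strict_left_mono) auto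
    then have "\<epsilon> * barrier_slope K m z1 * snd (m - 2 *\<^sub>R z1) + \<epsilon> * (\<omega> * barrier_size K m z1) + \<epsilon> * (\<bar>?c\<bar> * barrier K m z1)
       < \<epsilon> * (\<Sum>i\<in>UNIV. barrier_slope K m z1 * fst (m - 2 *\<^sub>R z1) $ i * ?b $ i)
         + \<epsilon> * (\<Sum>i\<in>UNIV. \<Sum>j\<in>UNIV. barrier_hess K m z1 $ i $ j * ?a $ i $ j)"
      unfolding distrib_left mult.assoc .
    ultimately show False using upper by linarith
  qed
  show thesis
  proof (rule that[OF \<epsilon>(1) \<delta>(1)])
    fix z :: "'n spt" assume z: "snd z \<le> 0" "norm z \<le> \<delta>" "sphere_defect m z \<ge> 0"
    then have zG: "z \<in> G" by (simp add: G_def)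
    have "\<epsilon> * sphere_defect m z \<le> \<epsilon> * barrier K m z" using qG[OF zG] \<epsilon>(1) by (intro mult_left_mono) auto
    also have "\<dots> \<le> u z - v z" by (rule claim[OF zG])
    finally show "\<epsilon> * sphere_defect m z \<le> u z - v z" .
  qed
qed

theorem theorem4p2:
  fixes \<Omega> S :: "((real ^ 'n::finite) \<times> real) set"
    and F :: "(real ^ 'n) \<times> real \<Rightarrow> real \<Rightarrow> real ^ 'n \<Rightarrow> real ^ 'n ^ 'n \<Rightarrow> real"
    and u v :: "(real ^ 'n) \<times> real \<Rightarrow> real"
    and k :: 'n
    and \<nu> N :: "(real ^ 'n) \<times> real"
  assumes "open \<Omega>" and "bounded \<Omega>" and "connected \<Omega>"
    and "\<Omega> \<subseteq> {z. snd z < 0}"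
    and "openin (top_of_set time_zero) S" and "S \<subseteq> frontier \<Omega>"
    and "continuous_on (closure \<Omega> \<times> UNIV \<times> UNIV \<times> sym_matrices) (\<lambda>(z, s, p, M). F z s p M)"
    and "C1_in_spM (closure \<Omega>) F"
    and "\<And>z s p M. z \<in> closure \<Omega> \<Longrightarrow> M \<in> sym_matrices \<Longrightarrow> positive_definite (deriv_M F z s p M)"
    and "0 \<in> rel_boundary S"
    and "C2_boundary_near {x. (x, 0) \<in> S} 0 (axis k 1)"
    and "\<nu> = (axis k 1, 0)"
    and "C2_parabolic_boundary_near \<Omega> S 0 N"
    and "N \<noteq> (0, 1)"
    and "lsc_on (closure \<Omega>) u"
    and "C2_on_closure \<Omega> v"
    and "viscosity_le F \<Omega> S u v"
    and "\<And>z. z \<in> closure \<Omega> \<Longrightarrow> u z \<ge> v z"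
    and "\<And>z. z \<in> \<Omega> \<union> S \<Longrightarrow> u z > v z"
    and "u 0 = v 0"
  shows "Liminf (at_right 0) (\<lambda>s. ereal ((u (s *\<^sub>R \<nu>) - v (s *\<^sub>R \<nu>)) / s)) > 0"
proof -
  have ST: "S \<subseteq> time_zero" using assms(5) openin_imp_subset by blast
  have Sc: "S \<subseteq> closure \<Omega>" using assms(6) by (auto simp: frontier_def)
  have "0 \<in> closure S" using assms(10) by (simp add: rel_boundary_eq_closure_minus[OF assms(5)])
  then have zero: "0 \<in> closure \<Omega>" using closure_minimal[OF Sc closed_closure] by blast
  obtain m where m: "(axis k 1, 0) \<bullet> m > 0"
    and ball: "\<And>z. z \<noteq> 0 \<Longrightarrow> z \<bullet> z \<le> z \<bullet> m \<Longrightarrow> snd z \<le> 0 \<Longrightarrow> z \<in> \<Omega> \<union> S"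
    by (rule interior_ball_at_corner[OF assms(1,4,5,6,11,13,14,10)]) (rule that)
  have \<nu>m: "\<nu> \<bullet> m > 0" using m assms(12) by simp
  have mne: "fst m \<noteq> 0" using m by (cases m) auto
  obtain \<epsilon> \<delta> where \<epsilon>: "\<epsilon> > 0" and \<delta>: "\<delta> > 0"
    and grow: "\<And>z. snd z \<le> 0 \<Longrightarrow> norm z \<le> \<delta> \<Longrightarrow> sphere_defect m z \<ge> 0 \<Longrightarrow> \<epsilon> * sphere_defect m z \<le> u z - v z"
    by (rule growth_from_interior_ball[OF assms(1,4) ST Sc assms(8,9,15,16,17,18,19) zero mne ball])
       (assumption+, rule that)
  have nn: "\<nu> \<bullet> \<nu> = 1" "norm \<nu> = 1" "snd \<nu> = 0" using assms(12) by (simp_all add: inner_axis_axis norm_Pair)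
  define d where "d = min \<delta> ((\<nu> \<bullet> m) / 2)"
  have d: "d > 0" using \<delta> \<nu>m by (simp add: d_def)
  have quot: "\<epsilon> * (\<nu> \<bullet> m) / 2 \<le> (u (s *\<^sub>R \<nu>) - v (s *\<^sub>R \<nu>)) / s" if s: "0 < s" "s < d" for s
  proof -
    have q: "sphere_defect m (s *\<^sub>R \<nu>) = s * (\<nu> \<bullet> m - s)" using nn by (simp add: sphere_defect_def algebra_simps)
    have half: "(\<nu> \<bullet> m) / 2 \<le> \<nu> \<bullet> m - s" using s by (simp add: d_def)
    have qs: "s * ((\<nu> \<bullet> m) / 2) \<le> sphere_defect m (s *\<^sub>R \<nu>)"
      unfolding q using half s by (intro mult_left_mono) auto
    have "0 \<le> s * ((\<nu> \<bullet> m) / 2)" using s \<nu>m by simp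
    with qs have "0 \<le> sphere_defect m (s *\<^sub>R \<nu>)" by linarith
    then have "\<epsilon> * sphere_defect m (s *\<^sub>R \<nu>) \<le> u (s *\<^sub>R \<nu>) - v (s *\<^sub>R \<nu>)"
      using s nn by (intro grow) (auto simp: d_def)
    moreover have "\<epsilon> * (s * ((\<nu> \<bullet> m) / 2)) \<le> \<epsilon> * sphere_defect m (s *\<^sub>R \<nu>)"
      using qs \<epsilon> by (intro mult_left_mono) auto
    ultimately have "(\<epsilon> * (\<nu> \<bullet> m) / 2) * s \<le> u (s *\<^sub>R \<nu>) - v (s *\<^sub>R \<nu>)" by (simp add: mult_ac)
    then show ?thesis using s by (simp add: pos_le_divide_eq)
  qed
  have "ereal (\<epsilon> * (\<nu> \<bullet> m) / 2) \<le> Liminf (at_right 0) (\<lambda>s. ereal ((u (s *\<^sub>R \<nu>) - v (s *\<^sub>R \<nu>)) / s))"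
    by (rule Liminf_bounded, rule eventually_mono[OF eventually_at_right_real[OF d]]) (use quot in auto)
  moreover have "0 < ereal (\<epsilon> * (\<nu> \<bullet> m) / 2)" using \<epsilon> \<nu>m by simp
  ultimately show ?thesis by (rule less_le_trans[rotated])
qed

end
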